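(* Let $p$ be a prime, let $k$ be a commutative reduced ring of characteristic $p$, and let $R=k[x,y]$ be the polynomial ring in two variables over $k$. Let $n,q\geq 1$ be integers, $h=x^n-y^q\in R$ and $A=R/\langle h\rangle$. Let $\alpha=\mathrm{val}_p(n)$ be the $p$-adic valuation of $n$, $s=n/p^\alpha$, let $m\in\{0,\dots,p-1\}$ be the remainder of the division of $q$ by $p$, let $\beta=\mathrm{val}_p(q-m)$ (with $\mathrm{val}_p(0)=\infty$), and let $\gamma=\min\{i\mid ip^\alpha\geq q-1\}=\lceil (q-1)/p^\alpha\rceil$. For a $k$-derivation $\delta$ of $R$ with $\delta(\langle h\rangle)\subseteq\langle h\rangle$, denote by $\overline{\delta}$ the induced $k$-derivation of $A$; below, $\langle\cdot\rangle$ applied to derivations of $A$ denotes the generated $A$-submodule of $\mathrm{Der}_k(A)$. Then: (1) If $n\not\equiv 0$ and $q\not\equiv 0 \pmod p$, then $\mathrm{IDer}_k(A)=\mathrm{Der}_k(A)=\langle \overline{\delta_1},\overline{\delta_2}\rangle$, where $\delta_1=qx\partial_x+ny\partial_y$ and $\delta_2=qy^{q-1}\partial_x+nx^{n-1}\partial_y$. (2) If $n\equiv 0\pmod p$ and $q=1$, then $\mathrm{IDer}_k(A)=\mathrm{Der}_k(A)=\langle\overline{\partial_x}\rangle$. (3) Suppose $\alpha\geq 1$, $m\geq 1$ and $q\geq 2$. (3a) If $s=1$, $\alpha\leq\beta$ and $m=1$, then $$\mathrm{IDer}_k(A;i)=\begin{cases}\langle\overline{\partial_x}\rangle & \text{if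 } 1\leq i<p^\alpha,\\ \langle\overline{x\partial_x},\overline{y^{\gamma}\partial_x}\rangle & \text{if } p^\alpha\leq i<p^{\alpha+\beta},\\ \langle\overline{x\partial_x},\overline{y^{\gamma+1}\partial_x}\rangle & \text{if } i\geq p^{\alpha+\beta}\text{ or } i=\infty.\end{cases}$$ (3b) Otherwise (i.e. if not all of $s=1$, $\alpha\leq\beta$, $m=1$ hold), $$\mathrm{IDer}_k(A;i)=\begin{cases}\langle\overline{\partial_x}\rangle & \text{if } 1\leq i<p^\alpha,\\ \langle\overline{x\partial_x},\overline{y^{\gamma}\partial_x}\rangle & \text{if } i\geq p^\alpha\text{ or } i=\infty.\end{cases}$$
   Context: For a commutative ring $k$ and a commutative $k$-algebra $A$, a Hasse-Schmidt derivation of $A$ over $k$ of length $m$ (an integer $m\geq 1$ or $m=\infty$) is a sequence $D=(D_0,D_1,\dots,D_m)$ (resp. $D=(D_0,D_1,\dots)$ if $m=\infty$) of $k$-linear maps $D_i:A\to A$ with $D_0=\mathrm{Id}_A$ and $D_i(xy)=\sum_{a+b=i}D_a(x)D_b(y)$ for all $x,y\in A$ and all $i$. The set of these is $\mathrm{HS}_k(A;m)$. The component $D_1$ is a $k$-derivation. A $k$-derivation $\delta\in\mathrm{Der}_k(A)$ is $m$-integrable if there is $D\in\mathrm{HS}_k(A;m)$ with $D_1=\delta$. $\mathrm{IDer}_k(A;m)$ is the set of $m$-integrable $k$-derivations (an $A$-submodule of $\mathrm{Der}_k(A)$), and $\mathrm{IDer}_k(A):=\mathrm{IDer}_k(A;\infty)$.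 *)

theory Defs
  imports "HOL-Algebra.Module" "HOL-Algebra.QuotRing" "HOL-Algebra.Algebraic_Closure_Type"
    "HOL-Computational_Algebra.Computational_Algebra" "HOL-Library.Extended_Nat"
begin

section \<open>Hasse--Schmidt derivations of a commutative algebra\<close>

text \<open>
  A commutative \<open>K\<close>-algebra is a record \<open>A\<close> with \<^term>\<open>algebra K A\<close>. All maps on \<open>A\<close> are
  extensional (\<^term>\<open>undefined\<close> off the carrier), so that equality of sets of maps is the
  usual one.
\<close>

definition linear_endos :: "('k, 'c) ring_scheme \<Rightarrow> ('k, 'a, 'm) module_scheme \<Rightarrow> ('a \<Rightarrow> 'a) set" where
  "linear_endos K A = {f \<in> carrier A \<rightarrow>\<^sub>E carrier A.
     (\<forall>x\<in>carrier A. \<forall>y\<in>carrier A. f (x \<oplus>\<^bsub>A\<^esub> y) = f x \<oplus>\<^bsub>A\<^esub> f y) \<and>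
     (\<forall>c\<in>carrier K. \<forall>x\<in>carrier A. f (c \<odot>\<^bsub>A\<^esub> x) = c \<odot>\<^bsub>A\<^esub> f x)}"

definition Der :: "('k, 'c) ring_scheme \<Rightarrow> ('k, 'a, 'm) module_scheme \<Rightarrow> ('a \<Rightarrow> 'a) set" where
  "Der K A = {\<delta> \<in> linear_endos K A. \<forall>x\<in>carrier A. \<forall>y\<in>carrier A.
     \<delta> (x \<otimes>\<^bsub>A\<^esub> y) = x \<otimes>\<^bsub>A\<^esub> \<delta> y \<oplus>\<^bsub>A\<^esub> y \<otimes>\<^bsub>A\<^esub> \<delta> x}"

text \<open>The length \<open>m\<close> ranges over \<^typ>\<open>enat\<close>; a sequence of length \<open>m\<close> is extensional on the
  indices \<open>i \<le> m\<close>.\<close>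

definition HS :: "('k, 'c) ring_scheme \<Rightarrow> ('k, 'a, 'm) module_scheme \<Rightarrow> enat \<Rightarrow> (nat \<Rightarrow> 'a \<Rightarrow> 'a) set" where
  "HS K A m = {D \<in> {i. enat i \<le> m} \<rightarrow>\<^sub>E linear_endos K A.
     D 0 = (\<lambda>x\<in>carrier A. x) \<and>
     (\<forall>i. enat i \<le> m \<longrightarrow> (\<forall>x\<in>carrier A. \<forall>y\<in>carrier A.
        D i (x \<otimes>\<^bsub>A\<^esub> y) = (\<Oplus>\<^bsub>A\<^esub>a\<in>{..i}. D a x \<otimes>\<^bsub>A\<^esub> D (i - a) y)))}"

definition IDer :: "('k, 'c) ring_scheme \<Rightarrow> ('k, 'a, 'm) module_scheme \<Rightarrow> enat \<Rightarrow> ('a \<Rightarrow> 'a) set" where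
  "IDer K A m = {\<delta> \<in> Der K A. \<exists>D\<in>HS K A m. D 1 = \<delta>}"

text \<open>The fields \<open>mult\<close> and \<open>one\<close> of a module record play no role for modules.\<close>

definition Der_module :: "('k, 'c) ring_scheme \<Rightarrow> ('k, 'a, 'm) module_scheme \<Rightarrow> ('a, 'a \<Rightarrow> 'a) module" where
  "Der_module K A = \<lparr>carrier = Der K A, monoid.mult = undefined, one = undefined,
     ring.zero = (\<lambda>x\<in>carrier A. \<zero>\<^bsub>A\<^esub>),
     add = (\<lambda>\<delta> \<epsilon>. \<lambda>x\<in>carrier A. \<delta> x \<oplus>\<^bsub>A\<^esub> \<epsilon> x),
     module.smult = (\<lambda>a \<delta>. \<lambda>x\<in>carrier A. a \<otimes>\<^bsub>A\<^esub> \<delta> x)\<rparr>"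

lemma Der_module_module: 
  assumes "algebra R M" shows "module M (Der_module R M)"
proof -
  interpret N: cring M using assms unfolding algebra_def by blast
  interpret A: algebra R M by fact
  have sm0: "a \<odot>\<^bsub>M\<^esub> \<zero>\<^bsub>M\<^esub> = \<zero>\<^bsub>M\<^esub>" if "a \<in> carrier R" for a
    using that by (rule A.smult_r_null)
  have sm: "x \<otimes>\<^bsub>M\<^esub> (c \<odot>\<^bsub>M\<^esub> y) = c \<odot>\<^bsub>M\<^esub> (x \<otimes>\<^bsub>M\<^esub> y)" if "c \<in> carrier R" "x \<in> carrier M" "y \<in> carrier M" for x y c
    using A.smult_assoc2[of c y x] that by (simp add: N.m_comm)
  have z: "(\<lambda>x\<in>carrier M. \<zero>\<^bsub>M\<^esub>) \<in> Der R M"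
    by (auto simp: Der_def linear_endos_def sm0)
  have a: "(\<lambda>x\<in>carrier M. d x \<oplus>\<^bsub>M\<^esub> e x) \<in> Der R M" if "d \<in> Der R M" "e \<in> Der R M" for d e
    using that by (auto simp: Der_def linear_endos_def PiE_iff N.a_ac N.l_distr N.r_distr A.smult_r_distr)
  have s: "(\<lambda>x\<in>carrier M. b \<otimes>\<^bsub>M\<^esub> d x) \<in> Der R M" if "d \<in> Der R M" "b \<in> carrier M" for d b
    using that by (auto simp: Der_def linear_endos_def PiE_iff N.m_ac N.l_distr N.r_distr sm)
  have m: "d x \<in> carrier M" if "d \<in> Der R M" "x \<in> carrier M" for d x
    using that by (auto simp: Der_def linear_endos_def PiE_iff)
  have ext: "d = (\<lambda>x\<in>carrier M. d x)" if "d \<in> Der R M" for d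
    using that by (auto simp: Der_def linear_endos_def PiE_iff extensional_restrict)
  have und: "d x = undefined" if "d \<in> Der R M" "x \<notin> carrier M" for d x
    using that by (auto simp: Der_def linear_endos_def PiE_iff extensional_def)
  have ng: "\<exists>y\<in>Der R M. (\<lambda>x\<in>carrier M. y x \<oplus>\<^bsub>M\<^esub> d x) = (\<lambda>x\<in>carrier M. \<zero>\<^bsub>M\<^esub>)" if "d \<in> Der R M" for d
  proof (rule bexI)
    show "(\<lambda>x\<in>carrier M. (\<ominus>\<^bsub>M\<^esub> \<one>\<^bsub>M\<^esub>) \<otimes>\<^bsub>M\<^esub> d x) \<in> Der R M" using s[OF that] by simp
    show "(\<lambda>x\<in>carrier M. (\<lambda>x\<in>carrier M. (\<ominus>\<^bsub>M\<^esub> \<one>\<^bsub>M\<^esub>) \<otimes>\<^bsub>M\<^esub> d x) x \<oplus>\<^bsub>M\<^esub> d x) = (\<lambda>x\<in>carrier M. \<zero>\<^bsub>M\<^esub>)"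
      using m[OF that] by (simp add: fun_eq_iff restrict_def N.l_minus N.l_neg)
  qed
  show ?thesis
  proof (rule moduleI)
    show "cring M" by (rule N.cring_axioms)
    show "abelian_group (Der_module R M)"
    proof (rule abelian_groupI)
      fix d assume d: "d \<in> carrier (Der_module R M)"
      then show "\<exists>y\<in>carrier (Der_module R M). y \<oplus>\<^bsub>Der_module R M\<^esub> d = \<zero>\<^bsub>Der_module R M\<^esub>"
        using ng by (simp add: Der_module_def)
      show "\<zero>\<^bsub>Der_module R M\<^esub> \<oplus>\<^bsub>Der_module R M\<^esub> d = d"
        using d m und[of d] by (simp add: Der_module_def fun_eq_iff restrict_def)
    next
      fix d e f assume "d \<in> carrier (Der_module R M)" "e \<in> carrier (Der_module R M)" "f \<in> carrier (Der_module R M)"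
      then show "d \<oplus>\<^bsub>Der_module R M\<^esub> e \<oplus>\<^bsub>Der_module R M\<^esub> f = d \<oplus>\<^bsub>Der_module R M\<^esub> (e \<oplus>\<^bsub>Der_module R M\<^esub> f)"
        using m by (simp add: Der_module_def fun_eq_iff restrict_def N.a_assoc)
    next
      fix d e assume "d \<in> carrier (Der_module R M)" "e \<in> carrier (Der_module R M)"
      then show "d \<oplus>\<^bsub>Der_module R M\<^esub> e = e \<oplus>\<^bsub>Der_module R M\<^esub> d" "d \<oplus>\<^bsub>Der_module R M\<^esub> e \<in> carrier (Der_module R M)"
        using m a by (simp_all add: Der_module_def fun_eq_iff restrict_def N.a_comm)
    qed (use z in \<open>simp add: Der_module_def\<close>)
  next
    fix d assume "d \<in> carrier (Der_module R M)"
    then show "\<one>\<^bsub>M\<^esub> \<odot>\<^bsub>Der_module R M\<^esub> d = d"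
      using m und[of d] by (simp add: Der_module_def fun_eq_iff restrict_def)
  next
    fix b d assume "b \<in> carrier M" "d \<in> carrier (Der_module R M)"
    then show "b \<odot>\<^bsub>Der_module R M\<^esub> d \<in> carrier (Der_module R M)" using s by (simp add: Der_module_def)
  qed (use m in \<open>simp_all add: Der_module_def fun_eq_iff restrict_def N.m_assoc N.l_distr N.r_distr\<close>)
qed

definition Der_span :: "('k, 'c) ring_scheme \<Rightarrow> ('k, 'a, 'm) module_scheme \<Rightarrow> ('a \<Rightarrow> 'a) set \<Rightarrow> ('a \<Rightarrow> 'a) set" where
  "Der_span K A S = \<Inter>{N. submodule N A (Der_module K A) \<and> S \<subseteq> N}"


section \<open>Quotient algebras and induced maps\<close>

text \<open>The scalar \<open>c\<close> acts on \<open>R Quot I\<close> as multiplication by the class of \<open>c \<odot> 1\<close>.\<close>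

definition quot_algebra :: "('k, 'a, 'm) module_scheme \<Rightarrow> 'a set \<Rightarrow> ('k, 'a set) module" where
  "quot_algebra R I = \<lparr>carrier = carrier (R Quot I), monoid.mult = monoid.mult (R Quot I),
     one = one (R Quot I), ring.zero = ring.zero (R Quot I), add = add (R Quot I),
     module.smult = (\<lambda>c C. (I +>\<^bsub>R\<^esub> (c \<odot>\<^bsub>R\<^esub> \<one>\<^bsub>R\<^esub>)) \<otimes>\<^bsub>R Quot I\<^esub> C)\<rparr>"

lemma (in algebra) quot_algebra_algebra:
  assumes "ideal I M" shows "algebra R (quot_algebra M I)"
proof -
  interpret I: ideal I M by fact
  have cringM: "cring M" by (rule algebra_axioms[unfolded algebra_def, THEN conjunct2, THEN conjunct1])
  have c: "cring (M Quot I)" by (rule I.quotient_is_cring) (rule cringM)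
  interpret Q: cring "M Quot I" by (rule c)
  have h: "(+>\<^bsub>M\<^esub>) I \<in> ring_hom M (M Quot I)" by (rule I.rcos_ring_hom)
  have cl: "I +>\<^bsub>M\<^esub> x \<in> carrier (M Quot I)" if "x \<in> carrier M" for x 
    using ring_hom_closed[OF h that] .
  note hm = ring_hom_mult[OF h] ring_hom_add[OF h] ring_hom_one[OF h]
  have eqc: "cring (quot_algebra M I)"
  proof (rule cringI, rule abelian_groupI)
    fix x assume "x \<in> carrier (quot_algebra M I)"
    then show "\<exists>y\<in>carrier (quot_algebra M I). y \<oplus>\<^bsub>quot_algebra M I\<^esub> x = \<zero>\<^bsub>quot_algebra M I\<^esub>"
      using Q.l_neg by (auto simp: quot_algebra_def intro!: bexI[of _ "\<ominus>\<^bsub>M Quot I\<^esub> x"])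
  qed (auto simp: quot_algebra_def Q.a_ac Q.m_ac Q.l_distr Q.r_distr intro!: comm_monoidI)
  have sa: "(a \<otimes> b) \<odot>\<^bsub>M\<^esub> \<one>\<^bsub>M\<^esub> = (a \<odot>\<^bsub>M\<^esub> \<one>\<^bsub>M\<^esub>) \<otimes>\<^bsub>M\<^esub> (b \<odot>\<^bsub>M\<^esub> \<one>\<^bsub>M\<^esub>)" if "a \<in> carrier R" "b \<in> carrier R" for a b
    using that by (simp add: smult_assoc1 smult_assoc2)
  show ?thesis
  proof (rule algebraI)
    show "cring R" by (rule R.cring_axioms)
    show "cring (quot_algebra M I)" by (rule eqc)
  qed (auto simp: quot_algebra_def Q.m_assoc cl smult_l_distr Q.l_distr Q.r_distr hm sa)
qed

text \<open>Meaningful only if \<open>\<delta>\<close> is additive and maps \<open>I\<close> into itself; then \<open>I + f\<close> goes to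
  \<open>I + \<delta> f\<close>.\<close>

definition induced :: "('a, 'm) ring_scheme \<Rightarrow> 'a set \<Rightarrow> ('a \<Rightarrow> 'a) \<Rightarrow> 'a set \<Rightarrow> 'a set" where
  "induced R I \<delta> = (\<lambda>C\<in>carrier (R Quot I). the_elem ((\<lambda>f. I +>\<^bsub>R\<^esub> \<delta> f) ` C))"


lemma induced_coset:
  assumes "ideal I R" "cring R" and d: "\<delta> \<in> carrier R \<rightarrow> carrier R"
   and add: "\<And>a b. a \<in> carrier R \<Longrightarrow> b \<in> carrier R \<Longrightarrow> \<delta> (a \<oplus>\<^bsub>R\<^esub> b) = \<delta> a \<oplus>\<^bsub>R\<^esub> \<delta> b" 
   and I: "\<delta> ` I \<subseteq> I" and f: "f \<in> carrier R"
  shows "induced R I \<delta> (I +>\<^bsub>R\<^esub> f) = I +>\<^bsub>R\<^esub> \<delta> f"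
proof -
  interpret I: ideal I R by fact
  have cl: "I +>\<^bsub>R\<^esub> f \<in> carrier (R Quot I)"
    using ring_hom_closed[OF I.rcos_ring_hom f] .
  have "(\<lambda>g. I +>\<^bsub>R\<^esub> \<delta> g) ` (I +>\<^bsub>R\<^esub> f) = {I +>\<^bsub>R\<^esub> \<delta> f}"
  proof -
    have "I +>\<^bsub>R\<^esub> \<delta> g = I +>\<^bsub>R\<^esub> \<delta> f" if "g \<in> I +>\<^bsub>R\<^esub> f" for g
    proof -
      from that obtain i where i: "i \<in> I" "g = i \<oplus>\<^bsub>R\<^esub> f" by (auto simp: a_r_coset_def')
      then have "\<delta> g = \<delta> i \<oplus>\<^bsub>R\<^esub> \<delta> f" using add f by auto
      then have "\<delta> g \<in> I +>\<^bsub>R\<^esub> \<delta> f" using i I by (auto simp: a_r_coset_def')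
      moreover have "\<delta> f \<in> carrier R" using d f by auto
      ultimately show ?thesis by (rule I.a_repr_independence[OF _ _ I.a_subgroup, symmetric])
    qed
    moreover have "f \<in> I +>\<^bsub>R\<^esub> f" by (rule I.a_rcos_self[OF f])
    ultimately show ?thesis by blast
  qed
  then show ?thesis using cl by (simp add: induced_def)
qed


section \<open>The polynomial ring in two variables\<close>

text \<open>\<open>k[x,y]\<close> is \<open>k[x][y]\<close>: the inner variable is \<open>x\<close>, the outer one is \<open>y\<close>.\<close>

definition poly_algebra :: "('k::comm_ring_1, 'k poly poly) module" where
  "poly_algebra = \<lparr>carrier = UNIV, monoid.mult = (*), one = 1, ring.zero = 0, add = (+),
     module.smult = (\<lambda>c. Polynomial.smult [:c:])\<rparr>"

lemma poly_algebra_algebra: "algebra (ring_of_type_algebra :: 'k::comm_ring_1 ring) poly_algebra"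
proof -
  interpret K: cring "ring_of_type_algebra :: 'k ring" by (rule cring_from_type_algebra)
  have ag: "\<exists>y. x + y = 0" for x :: "'k poly poly" by (rule exI[of _ "-x"]) simp
  show ?thesis
  proof (rule algebraI)
    show "cring (poly_algebra :: ('k, 'k poly poly) module)"
      by (rule cringI, rule abelian_groupI) (auto simp: poly_algebra_def algebra_simps ag intro!: comm_monoidI)
  next
    fix a b :: 'k
    have "[:a + b:] = [:a:] + [:b:]" "[:a * b:] = [:a:] * [:b:]" by simp_all
    then show "(a \<oplus>\<^bsub>ring_of_type_algebra\<^esub> b) \<odot>\<^bsub>poly_algebra\<^esub> x = a \<odot>\<^bsub>poly_algebra\<^esub> x \<oplus>\<^bsub>poly_algebra\<^esub> b \<odot>\<^bsub>poly_algebra\<^esub> x"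
       "(a \<otimes>\<^bsub>ring_of_type_algebra\<^esub> b) \<odot>\<^bsub>poly_algebra\<^esub> x = a \<odot>\<^bsub>poly_algebra\<^esub> (b \<odot>\<^bsub>poly_algebra\<^esub> x)" for x
      by (simp_all only: poly_algebra_def ring_of_type_algebra_def smult_add_left smult_smult module.simps ring.simps monoid.simps)
  qed (auto simp: poly_algebra_def ring_of_type_algebra_def smult_add_right K.cring_axioms[unfolded ring_of_type_algebra_def] simp flip: one_pCons)
qed

definition var_x :: "'k::comm_ring_1 poly poly" where
  "var_x = [:[:0, 1:]:]"

definition var_y :: "'k::comm_ring_1 poly poly" where
  "var_y = [:0, 1:]"

text \<open>The formal derivative; the library's \<^const>\<open>pderiv\<close> is restricted to coefficient rings
  without zero divisors.\<close>

definition formal_deriv :: "'a::comm_ring_1 poly \<Rightarrow> 'a poly" where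
  "formal_deriv f = (\<Sum>i\<le>degree f. monom (of_nat i * coeff f i) (i - 1))"

lemma formal_deriv_coeff: "coeff (formal_deriv f) i = of_nat (Suc i) * coeff f (Suc i)"
proof -
  have "coeff (formal_deriv f) i = (\<Sum>j\<le>degree f. if j - 1 = i then of_nat j * coeff f j else 0)"
    by (simp add: formal_deriv_def coeff_sum)
  also have "\<dots> = (\<Sum>j\<le>degree f. if j = Suc i then of_nat j * coeff f j else 0)"
    proof (intro sum.cong refl)
    fix x show "(if x - 1 = i then of_nat x * coeff f x else 0) = (if x = Suc i then of_nat x * coeff f x else 0)" by (cases x) auto
  qed
  also have "\<dots> = of_nat (Suc i) * coeff f (Suc i)"
    by (auto simp: coeff_eq_0)
  finally show ?thesis .
qed

definition partial_x :: "'k::comm_ring_1 poly poly \<Rightarrow> 'k poly poly" where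
  "partial_x = map_poly formal_deriv"

definition partial_y :: "'k::comm_ring_1 poly poly \<Rightarrow> 'k poly poly" where
  "partial_y = formal_deriv"


section \<open>Valuations\<close>

text \<open>Unlike \<^const>\<open>multiplicity\<close>, which is \<open>0\<close> at \<open>0\<close>, this has value \<open>\<infinity>\<close> there.\<close>

definition pval :: "nat \<Rightarrow> nat \<Rightarrow> enat" where
  "pval p a = (if a = 0 then \<infinity> else enat (multiplicity p a))"

end

theory Submission
  imports Defs
begin

text \<open>
  A Hasse--Schmidt derivation \<open>D\<close> of \<open>A = R / (h)\<close> of length \<open>l\<close> is a homomorphism
  \<open>f \<mapsto> \<Sum>j. D j f * t ^ j\<close> of \<open>k\<close>-algebras from \<open>A\<close> to \<open>A[[t]] / (t ^ (l + 1))\<close> that lifts the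
  identity. It is given by the images of \<open>x\<close> and \<open>y\<close>, so by two power series \<open>\<xi>\<close> and \<open>\<eta>\<close> over
  \<open>R\<close> that start with \<open>x\<close> and \<open>y\<close> and satisfy \<open>\<xi> ^ n = \<eta> ^ q\<close> modulo \<open>h\<close> up to order \<open>l\<close>; such
  a pair is called an arc below, and the derivation it integrates is
  \<open>\<xi> $ 1 * \<partial>x + \<eta> $ 1 * \<partial>y\<close> (\<open>IDer_eq_arcs\<close>). Since derivations are the case \<open>l = 1\<close>, the
  proposition asks which first-order terms occur in solutions of one equation, and everything
  happens in \<open>R[[t]]\<close>, with congruences modulo \<open>h\<close> in place of the quotient ring.

  Arcs come from two constructions. If \<open>(\<xi>, \<eta>)\<close> solves \<open>\<xi> ^ n = \<eta> ^ q\<close> then so does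
  \<open>(S ^ q * \<xi>, S ^ n * \<eta>)\<close> for any series \<open>S\<close>; with \<open>S = 1 + c * t\<close> this adds a multiple of the
  Euler derivation \<open>q * x * \<partial>x + n * y * \<partial>y\<close>. Moreover, if \<open>p\<close> does not divide \<open>q\<close> then every series with constant term
  \<open>1\<close> has a \<open>q\<close>-th root. So if \<open>z ^ s = y ^ q\<close>, the equation
  \<open>(z + y ^ (q - 1) * v * t) ^ s = \<eta> ^ q\<close> has the solution
  \<open>\<eta> = y * (1 + w * t) ^ (s / q)\<close> with \<open>w = z ^ (s - 1) * v / y\<close>, and for \<open>s \<ge> 2\<close> and \<open>q \<ge> 2\<close> the
  denominators cancel (\<open>branch_exists\<close>). With \<open>z = x\<close> this integrates every derivation when \<open>p\<close>
  divides neither exponent.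

  Let now \<open>p\<close> divide \<open>n\<close> but not \<open>q\<close>, and write \<open>n = P * s\<close> with \<open>P = p ^ \<alpha>\<close>. All
  derivations are multiples of \<open>\<partial>x\<close>, and \<open>\<xi> ^ n\<close> is a power of the series
  \<open>\<xi> ^ P = x ^ P + (\<xi> $ 1) ^ P * t ^ P + \<dots>\<close> in \<open>t ^ P\<close>. Hence nothing obstructs integration below
  order \<open>P\<close>, and at order \<open>P\<close> one finds \<open>s * x ^ (n - P) * (\<xi> $ 1) ^ P = q * y ^ (q - 1) * \<eta> $ P\<close>.
  As \<open>k\<close> is reduced, this puts \<open>\<xi> $ 1\<close> into the ideal of \<open>x\<close> and \<open>y ^ \<gamma>\<close>
  (\<open>arc_leading_ideal\<close>). Conversely \<open>\<xi> = x + v * y ^ \<gamma> * t\<close> extends to an arc, by a root if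
  \<open>\<gamma> * P \<ge> q\<close>, and by the construction above with \<open>z = x ^ P\<close> if \<open>\<gamma> * P = q - 1\<close> and \<open>s \<ge> 2\<close>.

  There remains \<open>s = 1\<close> and \<open>\<gamma> * P = q - 1\<close>, so that \<open>q = N * r + 1\<close> with \<open>N = p ^ \<beta>\<close>, \<open>P\<close>
  dividing \<open>N\<close> and \<open>p\<close> not dividing \<open>r\<close>. Then \<open>\<eta> ^ q = \<eta> * (\<eta> ^ r) ^ N\<close> is
  \<open>y ^ (q - 1) * \<eta>\<close> below order \<open>P * N\<close>, which makes the equation linear in \<open>\<eta>\<close> and solvable.
  At order \<open>P * N\<close> the new term \<open>r * y ^ (q - N) * (\<eta> $ P) ^ N\<close> appears. Its exponent \<open>q - N\<close> is
  less than \<open>q - 1\<close> and prime to \<open>p\<close>, so neither \<open>(\<xi> $ N) ^ P\<close> nor a multiple of \<open>y ^ (q - 1)\<close> can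
  compensate it; the constant term of \<open>\<eta> $ P\<close> must vanish, and with it that of the coefficient
  of \<open>y ^ \<gamma>\<close> in \<open>\<xi> $ 1\<close> (\<open>arc_leading_ideal_exceptional\<close>).
\<close>

section \<open>Congruences\<close>

definition congr :: "'a::comm_ring_1 \<Rightarrow> 'a \<Rightarrow> 'a \<Rightarrow> bool" where
  "congr h a b \<longleftrightarrow> h dvd a - b"

lemma congr_refl [simp]: "congr h a a"
  by (simp add: congr_def)

lemma congr_sym: "congr h a b \<Longrightarrow> congr h b a"
  unfolding congr_def by (metis dvd_minus_iff minus_diff_eq)

lemma congr_trans [trans]: "congr h a b \<Longrightarrow> congr h b c \<Longrightarrow> congr h a c"
  unfolding congr_def by (metis diff_add_cancel add_diff_eq dvd_add)

lemma congr_add: "congr h a b \<Longrightarrow> congr h c d \<Longrightarrow> congr h (a + c) (b + d)"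
  unfolding congr_def by (metis add_diff_add dvd_add)

lemma congr_diff: "congr h a b \<Longrightarrow> congr h c d \<Longrightarrow> congr h (a - c) (b - d)"
  unfolding congr_def by (metis diff_diff_eq2 diff_add_eq dvd_diff add_diff_eq diff_diff_add add.commute)

lemma congr_mult: "congr h a b \<Longrightarrow> congr h c d \<Longrightarrow> congr h (a * c) (b * d)"
proof -
  assume "congr h a b" "congr h c d"
  moreover have "a * c - b * d = (a - b) * c + b * (c - d)" by (simp add: algebra_simps)
  ultimately show ?thesis unfolding congr_def by (simp add: dvd_mult dvd_mult2)
qed

lemma congr_power: "congr h a b \<Longrightarrow> congr h (a ^ n) (b ^ n)"
  by (induction n) (auto intro: congr_mult)

lemma congr_sum: "(\<And>i. i \<in> S \<Longrightarrow> congr h (f i) (g i)) \<Longrightarrow> congr h (sum f S) (sum g S)"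
  by (induction S rule: infinite_finite_induct) (auto intro: congr_add)

lemma congr_0_iff: "congr h a 0 \<longleftrightarrow> h dvd a"
  by (simp add: congr_def)

lemma dvd_iff_congr: "congr h a b \<Longrightarrow> h dvd a \<longleftrightarrow> h dvd b"
  by (metis congr_0_iff congr_sym congr_trans)

lemma congr_fps_nth: "congr (fps_const h) F G \<Longrightarrow> congr h (F $ j) (G $ j)"
  unfolding congr_def dvd_def by (metis fps_mult_left_const_nth fps_sub_nth)

lemma congr_fpsI:
  assumes "\<And>j. congr h (F $ j) (G $ j)"
  shows "congr (fps_const h) F G"
proof -
  from assms have "\<exists>c. F $ j - G $ j = h * c" for j by (auto simp: congr_def dvd_def)
  then obtain c where "\<And>j. F $ j - G $ j = h * c j" by metis
  then have "F - G = fps_const h * Abs_fps c" by (simp add: fps_eq_iff)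
  then show ?thesis by (simp add: congr_def)
qed

lemma congr_fps_const: "congr h a b \<Longrightarrow> congr (fps_const h) (fps_const a) (fps_const b)"
  by (rule congr_fpsI) (simp add: congr_def)

section \<open>Low-order coefficients of powers of series\<close>

text \<open>Raising to the power \<open>p ^ e\<close> is additive, so it acts on each monomial separately.\<close>

lemma coeff_char_power:
  fixes f :: "'a::comm_ring_1 poly"
  assumes "Factorial_Ring.prime p" "CHAR('a) = p"
  shows "Polynomial.coeff (f ^ (p ^ e)) j =
         (if p ^ e dvd j then (Polynomial.coeff f (j div p ^ e)) ^ (p ^ e) else 0)"
proof (induction f arbitrary: j)
  case 0
  then show ?case using assms(1) by (auto simp: power_0_left prime_gt_0_nat)
next
  case (pCons a f)
  define P where "P = p ^ e"
  have P: "P > 0" using assms(1) by (simp add: P_def prime_gt_0_nat)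
  have "pCons a f ^ P = ([:a:] + monom 1 1 * f) ^ (p ^ e)"
    by (simp add: P_def monom_Suc monom_0)
  also have "\<dots> = [:a:] ^ P + (monom 1 1 * f) ^ P"
    using freshmans_dream'[of P e "[:a:]" "monom 1 1 * f"] assms by (simp add: P_def)
  also have "\<dots> = [:a ^ P:] + monom 1 P * f ^ P"
    by (simp add: power_mult_distrib monom_power poly_const_pow)
  finally have eq: "pCons a f ^ P = [:a ^ P:] + monom 1 P * f ^ P" .
  show ?case
  proof (cases "j < P")
    case True
    then have "P dvd j \<longleftrightarrow> j = 0" using P by (auto dest: dvd_imp_le)
    then show ?thesis using True P unfolding P_def[symmetric] eq
      by (auto simp: coeff_monom_mult coeff_pCons split: nat.splits)
  next
    case False
    then have "j > 0" "P dvd j \<longleftrightarrow> P dvd (j - P)" "j div P = Suc ((j - P) div P)"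
      using P by (auto simp: le_div_geq dvd_minus_self)
    then show ?thesis using False P pCons.IH[of "j - P"] unfolding P_def[symmetric] eq
      by (auto simp: coeff_monom_mult coeff_pCons split: nat.splits)
  qed
qed

text \<open>
  This reduces a single coefficient of a power of a series to that of a truncation, which is a
  polynomial.
\<close>

lemma fps_nth_power_cong:
  fixes F G :: "'a::comm_ring_1 fps"
  assumes "\<And>i. i \<le> j \<Longrightarrow> F $ i = G $ i"
  shows "(F ^ n) $ j = (G ^ n) $ j"
  using assms
proof (induction n arbitrary: j)
  case (Suc n)
  then show ?case by (auto simp: fps_mult_nth intro!: sum.cong)
qed simp

lemma fps_nth_char_power:
  fixes F :: "'a::comm_ring_1 fps"
  assumes "Factorial_Ring.prime p" "CHAR('a) = p"
  shows "(F ^ (p ^ e)) $ j = (if p ^ e dvd j then (F $ (j div p ^ e)) ^ (p ^ e) else 0)"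
proof -
  define f where "f = (\<Sum>i\<le>j. monom (F $ i) i)"
  have f: "Polynomial.coeff f i = (if i \<le> j then F $ i else 0)" for i
    by (simp add: f_def coeff_sum)
  have "(F ^ (p ^ e)) $ j = (fps_of_poly f ^ (p ^ e)) $ j"
    by (rule fps_nth_power_cong) (simp add: f)
  also have "\<dots> = Polynomial.coeff (f ^ (p ^ e)) j"
    by (simp add: fps_of_poly_power[symmetric])
  finally show ?thesis using coeff_char_power[OF assms, of f e j]
    by (simp add: f)
qed

text \<open>
  Modulo \<open>h\<close>, a term of order \<open>N\<close> in the \<open>q\<close>-th power takes \<open>Y $ N\<close> from one of the \<open>q\<close> factors
  and the constant term from all the others. The modulus \<open>h = 0\<close>
  gives the version with equality.
\<close>

lemma fps_nth_power_first_order: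
  fixes Y :: "'a::comm_ring_1 fps"
  assumes "N \<ge> 1" "\<And>j. 0 < j \<Longrightarrow> j < N \<Longrightarrow> h dvd Y $ j"
  shows "(\<forall>j. 0 < j \<and> j < N \<longrightarrow> h dvd (Y ^ q) $ j) \<and>
         congr h ((Y ^ q) $ N) (of_nat q * (Y $ 0) ^ (q - 1) * Y $ N)"
proof (induction q)
  case 0
  then show ?case using assms(1) by simp
next
  case (Suc q)
  have "h dvd (Y ^ Suc q) $ j" if "0 < j" "j < N" for j
  proof -
    have "h dvd Y $ i * (Y ^ q) $ (j - i)" if "i \<le> j" for i
      using that \<open>0 < j\<close> \<open>j < N\<close> Suc assms(2) by (cases "i = 0") auto
    then show ?thesis by (auto simp: fps_mult_nth intro!: dvd_sum)
  qed
  moreover have "congr h ((Y ^ Suc q) $ N) (of_nat (Suc q) * (Y $ 0) ^ (Suc q - 1) * Y $ N)"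
  proof -
    have "{0..N} = insert 0 (insert N {0<..<N})" using assms(1) by auto
    then have "(Y ^ Suc q) $ N = Y $ 0 * (Y ^ q) $ N + (Y $ N * (Y ^ q) $ 0 +
        (\<Sum>i\<in>{0<..<N}. Y $ i * (Y ^ q) $ (N - i)))"
      using assms(1) by (simp add: fps_mult_nth)
    moreover have "congr h (\<Sum>i\<in>{0<..<N}. Y $ i * (Y ^ q) $ (N - i)) 0"
      unfolding congr_0_iff by (intro dvd_sum) (use assms(2) in auto)
    moreover have "congr h (Y $ 0 * (Y ^ q) $ N) (Y $ 0 * (of_nat q * (Y $ 0) ^ (q - 1) * Y $ N))"
      using Suc by (intro congr_mult) auto
    ultimately have "congr h ((Y ^ Suc q) $ N)
        (Y $ 0 * (of_nat q * (Y $ 0) ^ (q - 1) * Y $ N) + (Y $ N * (Y ^ q) $ 0 + 0))"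
      by (simp only: congr_add congr_refl)
    also have "Y $ 0 * (of_nat q * (Y $ 0) ^ (q - 1) * Y $ N) + (Y $ N * (Y ^ q) $ 0 + 0) =
        of_nat (Suc q) * (Y $ 0) ^ (Suc q - 1) * Y $ N"
      by (cases q) (simp_all add: algebra_simps fps_nth_power_0)
    finally show ?thesis .
  qed
  ultimately show ?case by blast
qed

lemma char_power_linear:
  fixes a b :: "'a::comm_ring_1"
  assumes "Factorial_Ring.prime p" "CHAR('a) = p"
  shows "(fps_const a + fps_const b * fps_X) ^ (p ^ k) =
         fps_const (a ^ (p ^ k)) + fps_const (b ^ (p ^ k)) * fps_X ^ (p ^ k)"
  using freshmans_dream'[of "p ^ k" k "fps_const a" "fps_const b * fps_X"] assms
  by (simp add: power_mult_distrib fps_const_power)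

lemma fps_mult_nth_low_order:
  fixes F G :: "'a::comm_ring_1 fps"
  assumes "\<And>i. 0 < i \<Longrightarrow> i \<le> j \<Longrightarrow> G $ i = 0"
  shows "(F * G) $ j = F $ j * G $ 0"
proof -
  have "(F * G) $ j = (\<Sum>i=0..j. if i = j then F $ j * G $ 0 else 0)"
    unfolding fps_mult_nth by (intro sum.cong) (use assms in auto)
  then show ?thesis by simp
qed

lemma fps_linear_nth:
  fixes a b :: "'a::comm_ring_1"
  shows "(fps_const a + fps_const b * fps_X) $ 0 = a" "(fps_const a + fps_const b * fps_X) $ 1 = b"
  by simp_all

lemma power_linear_nth_1:
  fixes c :: "'a::comm_ring_1"
  shows "((1 + fps_const c * fps_X) ^ k) $ 0 = 1" "((1 + fps_const c * fps_X) ^ k) $ 1 = of_nat k * c"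
  using fps_nth_power_first_order[of 1 0 "1 + fps_const c * fps_X" k]
  by (simp_all add: congr_def fps_nth_power_0)

section \<open>Roots and fractional branches\<close>

text \<open>
  Newton iteration one order at a time: multiplying an approximate root by
  \<open>1 + c * t ^ Suc k\<close> changes the coefficient of order \<open>Suc k\<close> of its \<open>q\<close>-th power by \<open>q * c\<close> and
  none below, so \<open>c\<close> can be solved for because \<open>q\<close> is a unit.
\<close>

lemma fps_root_exists:
  fixes U :: "'a::comm_ring_1 fps"
  assumes e: "of_nat q * e = (1::'a)" and U: "U $ 0 = 1"
  shows "\<exists>W. W $ 0 = 1 \<and> W ^ q = U"
proof -
  define P where "P k W \<longleftrightarrow> W $ 0 = 1 \<and> (\<forall>j\<le>k. (W ^ q) $ j = U $ j)" for k :: nat and W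
  have "\<exists>f. \<forall>k. P k (f k) \<and> (\<forall>j\<le>k. f (Suc k) $ j = f k $ j)"
  proof (rule dependent_nat_choice)
    show "\<exists>W. P 0 W" using U by (intro exI[of _ 1]) (simp add: P_def fps_nth_power_0)
  next
    fix W k assume W: "P k W"
    define c where "c = e * (U $ Suc k - (W ^ q) $ Suc k)"
    define G where "G = 1 + fps_const c * fps_X ^ Suc k"
    have G: "G $ 0 = 1" "\<And>j. 0 < j \<Longrightarrow> j < Suc k \<Longrightarrow> G $ j = 0" "G $ Suc k = c"
      by (simp_all add: G_def fps_X_power_nth del: power_Suc)
    have Gq: "(G ^ q) $ 0 = 1" "\<And>j. 0 < j \<Longrightarrow> j < Suc k \<Longrightarrow> (G ^ q) $ j = 0"
       "(G ^ q) $ Suc k = of_nat q * c"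
      using fps_nth_power_first_order[of "Suc k" 0 G q] G
      by (simp_all add: congr_def fps_nth_power_0)
    have small: "(F * H) $ j = F $ j" if "j \<le> k" "H $ 0 = 1" "\<And>j. 0 < j \<Longrightarrow> j < Suc k \<Longrightarrow> H $ j = 0"
      for F H :: "'a fps" and j
      using that fps_mult_nth_low_order[of j H F] by simp
    have last: "(F * H) $ Suc k = F $ Suc k + F $ 0 * H $ Suc k"
      if "H $ 0 = 1" "\<And>j. 0 < j \<Longrightarrow> j < Suc k \<Longrightarrow> H $ j = 0" for F H :: "'a fps"
    proof -
      have "(F * H) $ Suc k = (\<Sum>i=0..Suc k. (if i = Suc k then F $ Suc k else 0) + (if i = 0 then F $ 0 * H $ Suc k else 0))"
        unfolding fps_mult_nth
      proof (intro sum.cong refl)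
        fix i assume "i \<in> {0..Suc k}"
        then consider "i = 0" | "i = Suc k" | "0 < Suc k - i" "Suc k - i < Suc k" by fastforce
        then show "F $ i * H $ (Suc k - i) = (if i = Suc k then F $ Suc k else 0) + (if i = 0 then F $ 0 * H $ Suc k else 0)"
          by cases (use that in auto)
      qed
      then show ?thesis by (simp add: sum.distrib)
    qed
    show "\<exists>V. P (Suc k) V \<and> (\<forall>j\<le>k. V $ j = W $ j)"
    proof (intro exI conjI)
      have "((W * G) ^ q) $ j = U $ j" if "j \<le> Suc k" for j
      proof (cases "j = Suc k")
        case False
        then show ?thesis using that small[of j "G ^ q" "W ^ q"] Gq W
          by (simp add: power_mult_distrib P_def)
      next
        case True
        have "of_nat q * c = U $ Suc k - (W ^ q) $ Suc k"
          by (simp add: c_def mult.assoc[symmetric] e)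
        then show ?thesis using True last[of "G ^ q" "W ^ q"] Gq W
          by (simp add: power_mult_distrib P_def fps_nth_power_0)
      qed
      then show "P (Suc k) (W * G)" using W G by (simp add: P_def)
      show "\<forall>j\<le>k. (W * G) $ j = W $ j" using small G by blast
    qed
  qed
  then obtain f where f: "\<And>k. P k (f k)" "\<And>k j. j \<le> k \<Longrightarrow> f (Suc k) $ j = f k $ j" by blast
  have st: "f (j + d) $ j = f j $ j" for j d
    by (induction d) (use f(2) in auto)
  define W where "W = Abs_fps (\<lambda>k. f k $ k)"
  have "(W ^ q) $ k = U $ k" for k
  proof -
    have "(W ^ q) $ k = (f k ^ q) $ k"
      by (rule fps_nth_power_cong) (use st in \<open>fastforce simp: W_def le_iff_add\<close>)
    then show ?thesis using f(1) by (simp add: P_def)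
  qed
  moreover have "W $ 0 = 1" using f(1)[of 0] by (simp add: W_def P_def)
  ultimately show ?thesis by (auto simp: fps_eq_iff)
qed

text \<open>The substitution \<open>t \<mapsto> c * t\<close>.\<close>

definition fps_scale :: "'a::comm_ring_1 \<Rightarrow> 'a fps \<Rightarrow> 'a fps" where
  "fps_scale c F = Abs_fps (\<lambda>j. c ^ j * F $ j)"

lemma fps_scale_mult: "fps_scale c (F * G) = fps_scale c F * fps_scale c G"
proof -
  have "c ^ j * (F $ i * G $ (j - i)) = c ^ i * F $ i * (c ^ (j - i) * G $ (j - i))" if "i \<le> j" for i j
  proof -
    have "c ^ j = c ^ i * c ^ (j - i)" using that by (simp flip: power_add)
    then show ?thesis by (simp add: algebra_simps)
  qed
  then show ?thesis
    by (auto simp: fps_scale_def fps_eq_iff fps_mult_nth sum_distrib_left intro!: sum.cong)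
qed

lemma fps_scale_power: "fps_scale c (F ^ n) = fps_scale c F ^ n"
  by (induction n) (simp_all add: fps_scale_mult, simp add: fps_scale_def fps_eq_iff)

text \<open>The substitution \<open>t \<mapsto> t ^ P\<close>, for \<open>P \<ge> 1\<close>.\<close>

definition fps_inflate :: "nat \<Rightarrow> 'a::comm_ring_1 fps \<Rightarrow> 'a fps" where
  "fps_inflate P F = Abs_fps (\<lambda>j. if P dvd j then F $ (j div P) else 0)"

lemma fps_inflate_add: "fps_inflate P (F + G) = fps_inflate P F + fps_inflate P G"
  by (simp add: fps_inflate_def fps_eq_iff)

lemma fps_inflate_const: "P \<ge> 1 \<Longrightarrow> fps_inflate P (fps_const c) = fps_const c"
  by (auto simp: fps_inflate_def fps_eq_iff dvd_div_eq_0_iff)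

lemma fps_inflate_X: "P \<ge> 1 \<Longrightarrow> fps_inflate P fps_X = fps_X ^ P"
  by (auto simp: fps_inflate_def fps_eq_iff fps_X_power_nth dvd_def)

lemma fps_inflate_mult:
  assumes "P \<ge> 1"
  shows "fps_inflate P (F * G) = fps_inflate P F * fps_inflate P G"
proof -
  have "fps_inflate P (F * G) $ j = (fps_inflate P F * fps_inflate P G) $ j" for j
  proof (cases "P dvd j")
    case False
    have "fps_inflate P F $ i * fps_inflate P G $ (j - i) = 0" if "i \<le> j" for i
      using False that by (auto simp: fps_inflate_def dest: dvd_diffD)
    then show ?thesis using False by (simp add: fps_inflate_def fps_mult_nth)
  next
    case True
    then obtain m where m: "j = P * m" by blast
    have "(fps_inflate P F * fps_inflate P G) $ j
        = (\<Sum>i\<in>(\<lambda>l. P * l) ` {0..m}. fps_inflate P F $ i * fps_inflate P G $ (j - i))"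
      unfolding fps_mult_nth by (rule sum.mono_neutral_right) (use m assms in \<open>auto simp: fps_inflate_def\<close>)
    also have "\<dots> = (\<Sum>l=0..m. F $ l * G $ (m - l))"
      using assms by (subst sum.reindex) (auto simp: inj_on_def fps_inflate_def m simp flip: diff_mult_distrib2)
    finally show ?thesis using assms by (simp add: fps_inflate_def fps_mult_nth m)
  qed
  then show ?thesis by (simp add: fps_eq_iff)
qed

lemma fps_inflate_power: "P \<ge> 1 \<Longrightarrow> fps_inflate P (F ^ n) = fps_inflate P F ^ n"
  using fps_inflate_const[of P "1::'a::comm_ring_1"] by (induction n) (simp_all add: fps_inflate_mult)

lemma fps_inflate_congr:
  assumes "P \<ge> 1" "congr (fps_const h) F G"
  shows "congr (fps_const h) (fps_inflate P F) (fps_inflate P G)"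
  by (rule congr_fpsI) (use congr_fps_nth[OF assms(2)] in \<open>simp add: fps_inflate_def\<close>)

text \<open>
  The series \<open>B\<close> is \<open>y * (1 + w * t) ^ (s / q)\<close> with \<open>w = z ^ (s - 1) * v / y\<close>. Its coefficient
  of order \<open>j\<close> contains \<open>z ^ (j * (s - 1)) / y ^ (j - 1)\<close>. Here \<open>z ^ (j * (s - 1))\<close> contains the
  factor \<open>z ^ s\<close> at least \<open>j div 2\<close> times because \<open>s \<ge> 2\<close>, and each of them is \<open>y ^ q\<close> with
  \<open>q \<ge> 2\<close>, which is enough to cancel \<open>y ^ (j - 1)\<close>; the quotient is \<open>r j\<close> in the proof. The
  identity between powers is checked after \<open>t \<mapsto> y * t\<close>, which removes all denominators and is
  injective modulo \<open>h\<close> as \<open>y\<close> is regular.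
\<close>

lemma branch_exists:
  fixes h y z v e :: "'a::comm_ring_1"
  assumes e: "of_nat q * e = (1::'a)" and s: "s \<ge> 2" and q: "q \<ge> 2"
    and zy: "congr h (z ^ s) (y ^ q)" and nzd: "\<And>f. h dvd y * f \<Longrightarrow> h dvd f"
  shows "\<exists>B. B $ 0 = y \<and> B $ 1 = e * of_nat s * z ^ (s - 1) * v \<and>
    congr (fps_const h) ((fps_const z + fps_const (y ^ (q - 1) * v) * fps_X) ^ s) (B ^ q)"
proof -
  obtain W :: "'a fps" where W: "W $ 0 = 1" "W ^ q = (1 + fps_X) ^ s"
    using fps_root_exists[OF e, of "(1 + fps_X) ^ s"] by (auto simp: fps_nth_power_0)
  have W1: "W $ 1 = e * of_nat s"
  proof -
    have a: "((1 + fps_X :: 'a fps) ^ s) $ 1 = of_nat s"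
      using fps_nth_power_first_order[of 1 0 "1 + fps_X :: 'a fps" s] by (simp add: congr_def)
    have b: "(W ^ q) $ 1 = of_nat q * W $ 1"
      using fps_nth_power_first_order[of 1 0 W q] W(1) by (simp add: congr_def)
    have "e * (of_nat q * W $ 1) = e * of_nat s" using a b W(2) by metis
    moreover have "e * (of_nat q * W $ 1) = (of_nat q * e) * W $ 1" by (simp add: algebra_simps)
    ultimately show ?thesis using e by simp
  qed
  \<comment> \<open>For \<open>j = 0\<close> the first exponent is \<open>1\<close>, so that \<open>r 0 = y\<close>.\<close>
  define r where "r j = y ^ (q * (j div 2) + 1 - j) * z ^ (j * (s - 1) - s * (j div 2))" for j
  define B where "B = Abs_fps (\<lambda>j. W $ j * r j * v ^ j)"
  have r: "congr h (y ^ j * r j) (y * z ^ (j * (s - 1)))" for j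
  proof -
    have "j \<le> q * (j div 2) + 1"
    proof -
      have "2 * (j div 2) \<le> q * (j div 2)" using q by simp
      then show ?thesis by linarith
    qed
    then have 1: "y ^ j * y ^ (q * (j div 2) + 1 - j) = y * (y ^ q) ^ (j div 2)"
      by (simp flip: power_add power_mult power_Suc)
    have "s * (j div 2) \<le> j * (s - 1)"
    proof -
      have "j div 2 \<le> j - j div 2" "j \<le> 2 * (j - j div 2)" by auto
      obtain s' where s': "s = Suc (Suc s')" using s by (metis add_2_eq_Suc le_Suc_ex)
      have "s * (j div 2) = 2 * (j div 2) + s' * (j div 2)" by (simp add: s')
      also have "\<dots> \<le> j + s' * j" by (intro add_mono mult_le_mono) auto
      finally show ?thesis by (simp add: s' algebra_simps)
    qed
    then have 2: "(z ^ s) ^ (j div 2) * z ^ (j * (s - 1) - s * (j div 2)) = z ^ (j * (s - 1))"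
      by (simp flip: power_add power_mult)
    have "y ^ j * r j = y * (y ^ q) ^ (j div 2) * z ^ (j * (s - 1) - s * (j div 2))"
      using 1 by (simp add: r_def mult.assoc[symmetric])
    also have "congr h \<dots> (y * (z ^ s) ^ (j div 2) * z ^ (j * (s - 1) - s * (j div 2)))"
      by (intro congr_mult congr_refl congr_power congr_sym[OF zy])
    also have "\<dots> = y * z ^ (j * (s - 1))" using 2 by (simp add: mult.assoc)
    finally show ?thesis .
  qed
  define L where "L = (fps_const z + fps_const (y ^ (q - 1) * v) * fps_X) ^ s"
  \<comment> \<open>the fraction \<open>z ^ (s - 1) * v / y\<close> after \<open>t \<mapsto> y * t\<close>\<close>
  define w where "w = z ^ (s - 1) * v"
  have BW: "congr (fps_const h) (fps_scale y B) (fps_const y * fps_scale w W)"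
  proof (rule congr_fpsI)
    fix j
    have "fps_scale y B $ j = (y ^ j * r j) * (W $ j * v ^ j)"
      by (simp add: fps_scale_def B_def algebra_simps)
    also have "congr h \<dots> (y * z ^ (j * (s - 1)) * (W $ j * v ^ j))"
      by (intro congr_mult r congr_refl)
    also have "\<dots> = (fps_const y * fps_scale w W) $ j"
      by (simp add: fps_scale_def w_def power_mult_distrib algebra_simps flip: power_mult)
    finally show "congr h (fps_scale y B $ j) ((fps_const y * fps_scale w W) $ j)" .
  qed
  have sX: "fps_scale w (1 + fps_X) = 1 + fps_const w * fps_X"
    by (auto simp: fps_scale_def fps_eq_iff fps_X_def)
  have "congr (fps_const h) (fps_scale y (B ^ q)) ((fps_const y * fps_scale w W) ^ q)"
    unfolding fps_scale_power by (rule congr_power[OF BW])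
  also have "(fps_const y * fps_scale w W) ^ q = fps_const (y ^ q) * (1 + fps_const w * fps_X) ^ s"
    by (simp add: power_mult_distrib fps_scale_power[symmetric] W(2))
       (simp add: fps_scale_power sX fps_const_power)
  also have "congr (fps_const h) \<dots> (fps_const (z ^ s) * (1 + fps_const w * fps_X) ^ s)"
    by (intro congr_mult congr_refl congr_fps_const congr_sym[OF zy])
  also have "fps_const (z ^ s) * (1 + fps_const w * fps_X) ^ s =
      (fps_const z + fps_const (z ^ s * v) * fps_X) ^ s"
  proof -
    have "z * w = z ^ s * v" using s by (simp add: w_def mult.assoc[symmetric] power_eq_if)
    then have "fps_const z * (1 + fps_const w * fps_X) = fps_const z + fps_const (z ^ s * v) * fps_X"
      by (simp add: distrib_left mult.assoc[symmetric] )
    then show ?thesis by (metis power_mult_distrib fps_const_power)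
  qed
  also have "congr (fps_const h) \<dots> ((fps_const z + fps_const (y ^ q * v) * fps_X) ^ s)"
    by (intro congr_mult congr_add congr_power congr_refl congr_fps_const zy)
  also have "(fps_const z + fps_const (y ^ q * v) * fps_X) ^ s = fps_scale y L"
  proof -
    have "y ^ q = y * y ^ (q - 1)" using q by (simp add: power_eq_if)
    then have "fps_scale y (fps_const z + fps_const (y ^ (q - 1) * v) * fps_X) =
        fps_const z + fps_const (y ^ q * v) * fps_X"
      by (auto simp: fps_scale_def fps_eq_iff fps_X_def)
    then show ?thesis by (simp add: L_def fps_scale_power)
  qed
  finally have sc: "congr (fps_const h) (fps_scale y (B ^ q)) (fps_scale y L)" .
  have can: "h dvd y ^ j * f \<Longrightarrow> h dvd f" for j f
  proof (induction j)
    case (Suc j)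
    then show ?case using nzd[of "y ^ j * f"] by (simp only: power_Suc mult.assoc)
  qed simp
  have "congr (fps_const h) L (B ^ q)"
  proof (rule congr_fpsI, rule congr_sym)
    fix j
    have "h dvd y ^ j * ((B ^ q) $ j - L $ j)"
      using congr_fps_nth[OF sc, of j] by (simp add: congr_def fps_scale_def algebra_simps)
    then show "congr h ((B ^ q) $ j) (L $ j)" unfolding congr_def by (rule can)
  qed
  moreover have "B $ 0 = y" "B $ 1 = e * of_nat s * z ^ (s - 1) * v"
    using W(1) W1 by (simp_all add: B_def r_def)
  ultimately show ?thesis unfolding L_def by blast
qed

text \<open>The weighted homogeneity of \<open>F ^ n = G ^ q\<close>.\<close>

lemma rescale_congr:
  assumes "congr (fps_const h) (F ^ n) (G ^ q)"
  shows "congr (fps_const h) ((S ^ q * F) ^ n) ((S ^ n * G) ^ q)"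
proof -
  have "congr (fps_const h) (S ^ (q * n) * F ^ n) (S ^ (q * n) * G ^ q)"
    by (intro congr_mult congr_refl assms)
  then show ?thesis by (simp add: power_mult_distrib mult.commute flip: power_mult)
qed

section \<open>The coordinate ring as classes of polynomials\<close>

abbreviation base_ring :: "'k::comm_ring_1 ring" where
  "base_ring \<equiv> ring_of_type_algebra"

abbreviation principal :: "'k::comm_ring_1 poly poly \<Rightarrow> 'k poly poly set" where
  "principal h \<equiv> genideal poly_algebra {h}"

abbreviation coord_ring :: "'k::comm_ring_1 poly poly \<Rightarrow> ('k, 'k poly poly set) module" where
  "coord_ring h \<equiv> quot_algebra poly_algebra (principal h)"

text \<open>
  The carrier of the coordinate ring consists of these classes, and all its operations are
  computed on representatives, so statements about it become congruences modulo \<open>h\<close>.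
\<close>

definition cls :: "'k::comm_ring_1 poly poly \<Rightarrow> 'k poly poly \<Rightarrow> 'k poly poly set" where
  "cls h f = principal h +>\<^bsub>poly_algebra\<^esub> f"

lemma poly_algebra_cring: "cring (poly_algebra :: ('k::comm_ring_1, 'k poly poly) module)"
  using poly_algebra_algebra by (auto simp: algebra_def)

lemma principal_ideal: "ideal (principal h) poly_algebra"
proof -
  interpret cring poly_algebra by (rule poly_algebra_cring)
  show ?thesis by (rule genideal_ideal) (simp add: poly_algebra_def)
qed

lemma principal_eq: "principal h = {f. h dvd f}"
proof -
  interpret cring poly_algebra by (rule poly_algebra_cring)
  show ?thesis
    using cgenideal_eq_genideal[of h]
    by (auto simp: poly_algebra_def cgenideal_def dvd_def mult.commute)
qed

lemma cls_eq_iff: "cls h f = cls h g \<longleftrightarrow> congr h f g"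
proof -
  have cls: "cls h f = {g. congr h g f}" for f
  proof -
    have "cls h f = {i + f | i. h dvd i}"
      unfolding cls_def a_r_coset_def' principal_eq by (auto simp: poly_algebra_def)
    also have "\<dots> = {g. congr h g f}"
      by (auto simp: congr_def intro!: exI[of _ "_ - f"])
    finally show ?thesis .
  qed
  show ?thesis unfolding cls using congr_refl congr_sym congr_trans by blast
qed

lemma coord_ring_algebra: "algebra base_ring (coord_ring h)"
  by (rule algebra.quot_algebra_algebra[OF poly_algebra_algebra principal_ideal])

lemma coord_ring_carrier: "carrier (coord_ring h) = range (cls h)"
  by (auto simp: quot_algebra_def FactRing_def A_RCOSETS_def' cls_def poly_algebra_def)

lemma cls_carrier [simp]: "cls h f \<in> carrier (coord_ring h)"
  by (simp add: coord_ring_carrier)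

lemma ball_coord_ring: "(\<forall>C\<in>carrier (coord_ring h). P C) \<longleftrightarrow> (\<forall>f. P (cls h f))"
  by (auto simp: coord_ring_carrier)

lemma cls_ring_hom: "cls h \<in> ring_hom poly_algebra (poly_algebra Quot (principal h))"
  using ideal.rcos_ring_hom[OF principal_ideal, of h] by (simp add: cls_def[abs_def])

lemma cls_add [simp]: "cls h f \<oplus>\<^bsub>coord_ring h\<^esub> cls h g = cls h (f + g)"
  using ring_hom_add[OF cls_ring_hom, of f g h] by (simp add: quot_algebra_def poly_algebra_def)

lemma cls_mult [simp]: "cls h f \<otimes>\<^bsub>coord_ring h\<^esub> cls h g = cls h (f * g)"
  using ring_hom_mult[OF cls_ring_hom, of f g h] by (simp add: quot_algebra_def poly_algebra_def)

lemma cls_one: "\<one>\<^bsub>coord_ring h\<^esub> = cls h 1"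
  using ring_hom_one[OF cls_ring_hom, of h] by (simp add: quot_algebra_def poly_algebra_def)

lemma cls_zero: "\<zero>\<^bsub>coord_ring h\<^esub> = cls h 0"
proof -
  interpret algebra base_ring "coord_ring h" by (rule coord_ring_algebra)
  have "cls h 0 \<oplus>\<^bsub>coord_ring h\<^esub> cls h 0 = cls h 0" by simp
  then show ?thesis by (metis cls_carrier M.add.l_cancel_one)
qed

lemma cls_smult [simp]: "c \<odot>\<^bsub>coord_ring h\<^esub> cls h f = cls h ([:[:c:]:] * f)"
proof -
  have "c \<odot>\<^bsub>coord_ring h\<^esub> cls h f = cls h [:[:c:]:] \<otimes>\<^bsub>coord_ring h\<^esub> cls h f"
    by (simp add: quot_algebra_def cls_def poly_algebra_def)
  then show ?thesis by simp
qed

lemma cls_finsum: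
  assumes "finite S"
  shows "(\<Oplus>\<^bsub>coord_ring h\<^esub>a\<in>S. cls h (F a)) = cls h (\<Sum>a\<in>S. F a)"
proof -
  interpret algebra base_ring "coord_ring h" by (rule coord_ring_algebra)
  show ?thesis using assms
    by (induction S) (simp_all add: cls_zero M.finsum_insert)
qed

lemma linear_endos_coord_ring:
  fixes h :: "'k::comm_ring_1 poly poly"
  shows
  "D \<in> linear_endos base_ring (coord_ring h) \<longleftrightarrow>
   D \<in> carrier (coord_ring h) \<rightarrow>\<^sub>E carrier (coord_ring h) \<and>
   (\<forall>f g. D (cls h (f + g)) = D (cls h f) \<oplus>\<^bsub>coord_ring h\<^esub> D (cls h g)) \<and>
   (\<forall>c f. D (cls h ([:[:c:]:] * f)) = c \<odot>\<^bsub>coord_ring h\<^esub> D (cls h f))"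
proof -
  have "carrier (base_ring :: 'k ring) = UNIV" by (simp add: ring_of_type_algebra_def)
  then show ?thesis unfolding linear_endos_def by (simp only: mem_Collect_eq ball_coord_ring cls_add cls_smult ball_UNIV)
qed


section \<open>Substitution of power series\<close>

definition hom_eval :: "('a::comm_ring_1 \<Rightarrow> 'b::comm_ring_1) \<Rightarrow> 'b \<Rightarrow> 'a poly \<Rightarrow> 'b" where
  "hom_eval \<phi> \<eta> f = poly (map_poly \<phi> f) \<eta>"

context
  fixes \<phi> :: "'a::comm_ring_1 \<Rightarrow> 'b::comm_ring_1"
  assumes add: "\<And>a b. \<phi> (a + b) = \<phi> a + \<phi> b" and mult: "\<And>a b. \<phi> (a * b) = \<phi> a * \<phi> b"
begin

lemma hom_zero: "\<phi> 0 = 0"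
  using add[of 0 0] by simp

lemma hom_eval_pCons: "hom_eval \<phi> \<eta> (pCons c f) = \<phi> c + \<eta> * hom_eval \<phi> \<eta> f"
  by (simp add: hom_eval_def map_poly_pCons hom_zero)

lemma hom_eval_add: "hom_eval \<phi> \<eta> (f + g) = hom_eval \<phi> \<eta> f + hom_eval \<phi> \<eta> g"
  by (induction f g rule: poly_induct2)
     (simp_all add: hom_eval_pCons add algebra_simps, simp add: hom_eval_def)

lemma hom_eval_mult: "hom_eval \<phi> \<eta> (f * g) = hom_eval \<phi> \<eta> f * hom_eval \<phi> \<eta> g"
proof (induction f)
  case 0
  then show ?case by (simp add: hom_eval_def)
next
  case (pCons c f)
  have "hom_eval \<phi> \<eta> (Polynomial.smult c g) = \<phi> c * hom_eval \<phi> \<eta> g" for g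
  proof (induction g)
    case 0
    then show ?case by (simp add: hom_eval_def)
  qed (simp add: hom_eval_pCons mult algebra_simps)
  then show ?case
    by (simp add: hom_eval_pCons hom_eval_add pCons.IH hom_zero algebra_simps)
qed

end

text \<open>
  The homomorphism of \<open>k\<close>-algebras with \<open>x \<mapsto> \<xi>\<close> and \<open>y \<mapsto> \<eta>\<close>. It is an iterated evaluation
  because \<open>k[x,y]\<close> is \<open>k[x][y]\<close>.
\<close>

definition series_subst ::
    "'k::comm_ring_1 poly poly fps \<Rightarrow> 'k poly poly fps \<Rightarrow> 'k poly poly \<Rightarrow> 'k poly poly fps" where
  "series_subst \<xi> \<eta> = hom_eval (hom_eval (\<lambda>a. fps_const [:[:a:]:]) \<xi>) \<eta>"

context
  fixes \<xi> \<eta> :: "'k::comm_ring_1 poly poly fps"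
begin

lemma const_hom:
  "fps_const [:[:a + b:]:] = fps_const [:[:a:]:] + fps_const [:[:b::'k:]:]"
  "fps_const [:[:a * b:]:] = fps_const [:[:a:]:] * fps_const [:[:b::'k:]:]"
  by simp_all

lemmas inner_hom = hom_eval_add[of "\<lambda>a::'k. fps_const [:[:a:]:]" \<xi>, OF const_hom]
  hom_eval_mult[of "\<lambda>a::'k. fps_const [:[:a:]:]" \<xi>, OF const_hom]

lemma series_subst_add: "series_subst \<xi> \<eta> (f + g) = series_subst \<xi> \<eta> f + series_subst \<xi> \<eta> g"
  unfolding series_subst_def by (rule hom_eval_add) (rule inner_hom)+

lemma series_subst_mult: "series_subst \<xi> \<eta> (f * g) = series_subst \<xi> \<eta> f * series_subst \<xi> \<eta> g"
  unfolding series_subst_def by (rule hom_eval_mult) (rule inner_hom)+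

lemma series_subst_const: "series_subst \<xi> \<eta> [:[:c:]:] = fps_const [:[:c:]:]"
  by (simp add: series_subst_def hom_eval_def map_poly_pCons)

lemma series_subst_x: "series_subst \<xi> \<eta> var_x = \<xi>"
  by (simp add: series_subst_def hom_eval_def map_poly_pCons var_x_def flip: one_pCons)

lemma series_subst_y: "series_subst \<xi> \<eta> var_y = \<eta>"
  by (simp add: series_subst_def hom_eval_def map_poly_pCons var_y_def flip: one_pCons)

lemma series_subst_1: "series_subst \<xi> \<eta> 1 = 1"
  using series_subst_const[of 1] by (simp flip: one_pCons)

lemma series_subst_power: "series_subst \<xi> \<eta> (f ^ n) = series_subst \<xi> \<eta> f ^ n"
  by (induction n) (simp_all add: series_subst_1 series_subst_mult)

lemma series_subst_diff: "series_subst \<xi> \<eta> (f - g) = series_subst \<xi> \<eta> f - series_subst \<xi> \<eta> g"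
  using series_subst_add[of "f - g" g] by simp

end

text \<open>
  Reduces identities between maps on \<open>k[x,y]\<close> that are compatible with sums and products to the
  generators.
\<close>

lemma poly_poly_induct [case_names const x y add mult]:
  fixes f :: "'k::comm_ring_1 poly poly"
  assumes const: "\<And>c. P [:[:c:]:]" and x: "P var_x" and y: "P var_y"
    and add: "\<And>f g. P f \<Longrightarrow> P g \<Longrightarrow> P (f + g)" and mult: "\<And>f g. P f \<Longrightarrow> P g \<Longrightarrow> P (f * g)"
  shows "P f"
proof (induction f)
  case 0
  then show ?case using const[of 0] by simp
next
  case (pCons c f)
  have "P [:c:]"
  proof (induction c)
    case 0
    then show ?case using const[of 0] by simp
  next
    case (pCons a c)
    have "P ([:[:a:]:] + var_x * [:c:])" by (intro add mult const x pCons.IH)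
    then show ?case by (simp add: var_x_def)
  qed
  then have "P ([:c:] + var_y * f)" by (intro add mult y pCons.IH)
  then show ?case by (simp add: var_y_def)
qed

lemma formal_deriv_0: "formal_deriv 0 = 0"
  by (rule poly_eqI) (simp add: formal_deriv_coeff)

lemma formal_deriv_pCons: "formal_deriv (pCons a f) = f + pCons 0 (formal_deriv f)"
  by (rule poly_eqI) (simp add: formal_deriv_coeff coeff_pCons algebra_simps split: nat.split)

lemma formal_deriv_add: "formal_deriv (f + g) = formal_deriv f + formal_deriv g"
  by (rule poly_eqI) (simp add: formal_deriv_coeff algebra_simps)

lemma formal_deriv_mult: "formal_deriv (f * g) = f * formal_deriv g + g * formal_deriv f"
proof (induction f)
  case 0
  then show ?case by (simp add: formal_deriv_0)
next
  case (pCons a f)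
  have "formal_deriv (Polynomial.smult a g) = Polynomial.smult a (formal_deriv g)"
    by (rule poly_eqI) (simp add: formal_deriv_coeff algebra_simps)
  then show ?case
    by (simp add: formal_deriv_add formal_deriv_pCons pCons.IH algebra_simps)
qed

lemma partial_x_0: "partial_x 0 = 0"
  by (simp add: partial_x_def)

lemma partial_x_pCons: "partial_x (pCons c f) = pCons (formal_deriv c) (partial_x f)"
  by (simp add: partial_x_def map_poly_pCons formal_deriv_0)

lemma partial_x_add: "partial_x (f + g) = partial_x f + partial_x g"
  by (rule poly_eqI) (simp add: partial_x_def coeff_map_poly formal_deriv_0 formal_deriv_add)

lemma partial_x_mult: "partial_x (f * g) = f * partial_x g + g * partial_x f"
proof (induction f)
  case 0
  then show ?case by (simp add: partial_x_def)
next
  case (pCons a f)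
  have "partial_x (Polynomial.smult a g) = Polynomial.smult a (partial_x g) + Polynomial.smult (formal_deriv a) g"
    by (rule poly_eqI)
       (simp add: partial_x_def coeff_map_poly formal_deriv_0 formal_deriv_mult algebra_simps)
  then show ?case
    by (simp add: partial_x_add partial_x_pCons pCons.IH formal_deriv_0 algebra_simps)
qed

text \<open>Taylor expansion to first order; both sides satisfy the Leibniz rule.\<close>

lemma series_subst_low_order:
  fixes \<xi> \<eta> :: "'a::comm_ring_1 poly poly fps"
  assumes "\<xi> $ 0 = var_x" "\<eta> $ 0 = var_y"
  shows "series_subst \<xi> \<eta> f $ 0 = f \<and>
         series_subst \<xi> \<eta> f $ 1 = \<xi> $ 1 * partial_x f + \<eta> $ 1 * partial_y f"
proof (induction f rule: poly_poly_induct)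
  case (const c)
  then show ?case
    by (simp add: series_subst_const partial_x_pCons partial_y_def formal_deriv_pCons formal_deriv_0 partial_x_0)
next
  case x
  have "partial_x var_x = (1 :: 'a poly poly)" "partial_y var_x = (0 :: 'a poly poly)"
    by (simp_all add: var_x_def partial_x_pCons partial_x_0 partial_y_def formal_deriv_pCons formal_deriv_0 one_pCons)
  then show ?case using assms by (simp add: series_subst_x)
next
  case y
  have "partial_x var_y = (0 :: 'a poly poly)" "partial_y var_y = (1 :: 'a poly poly)"
    by (simp_all add: var_y_def partial_x_pCons partial_x_0 partial_y_def formal_deriv_pCons formal_deriv_0 one_pCons)
  then show ?case using assms by (simp add: series_subst_y)
next
  case (add f g)
  then show ?case by (simp add: series_subst_add partial_x_add partial_y_def formal_deriv_add algebra_simps)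
next
  case (mult f g)
  then show ?case
    by (simp add: series_subst_mult partial_x_mult partial_y_def formal_deriv_mult fps_mult_nth algebra_simps)
qed

section \<open>Integrable derivations as arcs\<close>

definition vfield :: "'k::comm_ring_1 poly poly \<Rightarrow> 'k poly poly \<Rightarrow> 'k poly poly \<Rightarrow> 'k poly poly set \<Rightarrow> 'k poly poly set" where
  "vfield h a b = induced poly_algebra (principal h) (\<lambda>f. a * partial_x f + b * partial_y f)"

lemma induced_cls:
  assumes "\<And>f g. \<delta> (f + g) = \<delta> f + \<delta> g" "\<And>f. h dvd f \<Longrightarrow> h dvd \<delta> f"
  shows "induced poly_algebra (principal h) \<delta> (cls h f) = cls h (\<delta> f)"
  unfolding cls_def
  by (rule induced_coset[OF principal_ideal poly_algebra_cring])
     (use assms in \<open>auto simp: principal_eq, auto simp: poly_algebra_def\<close>)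

lemma induced_extensional: "induced poly_algebra (principal h) \<delta> \<in> extensional (carrier (coord_ring h))"
  by (simp add: induced_def quot_algebra_def)

lemma coord_ring_ext:
  assumes "D \<in> extensional (carrier (coord_ring h))" "E \<in> extensional (carrier (coord_ring h))"
    and "\<And>f. D (cls h f) = E (cls h f)"
  shows "D = E"
  by (rule extensionalityI[OF assms(1,2)]) (use assms(3) in \<open>auto simp: coord_ring_carrier\<close>)

text \<open>
  The pair moves the tautological point \<open>(x, y)\<close> of the zero set of \<open>h\<close>, and up to order \<open>m\<close> it
  does not leave that set.
\<close>

definition arc :: "'k::comm_ring_1 poly poly \<Rightarrow> enat \<Rightarrow> 'k poly poly fps \<Rightarrow> 'k poly poly fps \<Rightarrow> bool" where
  "arc h m \<xi> \<eta> \<longleftrightarrow> \<xi> $ 0 = var_x \<and> \<eta> $ 0 = var_y \<and> (\<forall>j. enat j \<le> m \<longrightarrow> h dvd series_subst \<xi> \<eta> h $ j)"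

text \<open>
  The coefficients of the substitution preserve the ideal of \<open>h\<close> up to order \<open>m\<close>, and the
  Leibniz rules say that the substitution is multiplicative.
\<close>

lemma HS_of_arc:
  assumes "arc h m \<xi> \<eta>"
  shows "(\<lambda>j. if enat j \<le> m then induced poly_algebra (principal h) (\<lambda>f. series_subst \<xi> \<eta> f $ j) else undefined)
           \<in> HS base_ring (coord_ring h) m"
proof -
  have stable: "h dvd series_subst \<xi> \<eta> f $ j" if "h dvd f" "enat j \<le> m" for f j
  proof -
    from that obtain g where g: "f = h * g" by blast
    have "enat i \<le> m" if "i \<le> j" for i using that \<open>enat j \<le> m\<close> by (meson enat_ord_simps(1) order_trans)
    then show ?thesis using assms
      by (auto simp: g series_subst_mult fps_mult_nth arc_def intro!: dvd_sum dvd_mult2)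
  qed
  define D where
    "D j = (if enat j \<le> m then induced poly_algebra (principal h) (\<lambda>f. series_subst \<xi> \<eta> f $ j) else undefined)" for j
  have D: "D j (cls h f) = cls h (series_subst \<xi> \<eta> f $ j)" if "enat j \<le> m" for j f
    using that by (simp add: D_def induced_cls series_subst_add stable)
  have lin: "D j \<in> linear_endos base_ring (coord_ring h)" if "enat j \<le> m" for j
  proof -
    have "D j \<in> extensional (carrier (coord_ring h))"
      using that by (simp add: D_def induced_extensional)
    moreover have "D j C \<in> carrier (coord_ring h)" if "C \<in> carrier (coord_ring h)" for C
      using that D[OF \<open>enat j \<le> m\<close>] by (auto simp: coord_ring_carrier)
    ultimately show ?thesis
      unfolding linear_endos_coord_ring D[OF that]
      by (simp add: PiE_def Pi_def series_subst_add series_subst_mult series_subst_const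
          del: mult_pCons_left)
  qed
  have id: "D 0 = (\<lambda>x\<in>carrier (coord_ring h). x)"
  proof (rule coord_ring_ext)
    show "D 0 (cls h f) = (\<lambda>x\<in>carrier (coord_ring h). x) (cls h f)" for f
      using D[of 0 f] series_subst_low_order[of \<xi> \<eta> f] assms by (simp add: arc_def zero_enat_def[symmetric])
  qed (simp_all add: D_def induced_extensional zero_enat_def[symmetric])
  have leib: "D i (cls h f \<otimes>\<^bsub>coord_ring h\<^esub> cls h g) =
       (\<Oplus>\<^bsub>coord_ring h\<^esub>a\<in>{..i}. D a (cls h f) \<otimes>\<^bsub>coord_ring h\<^esub> D (i - a) (cls h g))"
    if "enat i \<le> m" for i f g
  proof -
    interpret algebra base_ring "coord_ring h" by (rule coord_ring_algebra)
    have le: "enat l \<le> m" if "l \<le> i" for l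
      using that \<open>enat i \<le> m\<close> by (meson enat_ord_simps(1) order_trans)
    have "(\<Oplus>\<^bsub>coord_ring h\<^esub>a\<in>{..i}. D a (cls h f) \<otimes>\<^bsub>coord_ring h\<^esub> D (i - a) (cls h g)) =
      (\<Oplus>\<^bsub>coord_ring h\<^esub>a\<in>{..i}. cls h (series_subst \<xi> \<eta> f $ a * series_subst \<xi> \<eta> g $ (i - a)))"
    proof (rule M.finsum_cong'[OF refl])
      fix a assume "a \<in> {..i}"
      then have "a \<le> i" "i - a \<le> i" by auto
      then show "D a (cls h f) \<otimes>\<^bsub>coord_ring h\<^esub> D (i - a) (cls h g) =
          cls h (series_subst \<xi> \<eta> f $ a * series_subst \<xi> \<eta> g $ (i - a))"
        by (simp only: D le cls_mult)
    qed simp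
    then show ?thesis using D[OF that, of "f * g"]
      by (simp add: cls_finsum series_subst_mult fps_mult_nth atLeast0AtMost)
  qed
  show ?thesis
    unfolding D_def[symmetric] HS_def mem_Collect_eq ball_coord_ring
    using lin id leib by (auto simp: PiE_def extensional_def D_def)
qed

lemma Leibniz_coord_ring:
  fixes i :: nat
  assumes D: "\<And>j f. j \<le> i \<Longrightarrow> D j (cls h f) = cls h (F j f)"
    and leib: "D i (cls h f \<otimes>\<^bsub>coord_ring h\<^esub> cls h g) =
       (\<Oplus>\<^bsub>coord_ring h\<^esub>a\<in>{..i}. D a (cls h f) \<otimes>\<^bsub>coord_ring h\<^esub> D (i - a) (cls h g))"
  shows "cls h (F i (f * g)) = cls h (\<Sum>a\<le>i. F a f * F (i - a) g)"
proof -
  interpret algebra base_ring "coord_ring h" by (rule coord_ring_algebra)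
  have "(\<Oplus>\<^bsub>coord_ring h\<^esub>a\<in>{..i}. D a (cls h f) \<otimes>\<^bsub>coord_ring h\<^esub> D (i - a) (cls h g)) =
      (\<Oplus>\<^bsub>coord_ring h\<^esub>a\<in>{..i}. cls h (F a f * F (i - a) g))"
  proof (rule M.finsum_cong'[OF refl])
    fix a assume "a \<in> {..i}"
    then have "a \<le> i" "i - a \<le> i" by auto
    then show "D a (cls h f) \<otimes>\<^bsub>coord_ring h\<^esub> D (i - a) (cls h g) = cls h (F a f * F (i - a) g)"
      by (simp only: D cls_mult)
  qed simp
  then show ?thesis using D[of i "f * g"] leib by (simp add: cls_finsum)
qed

text \<open>
  Choose representatives of \<open>D j x\<close> and \<open>D j y\<close>, with \<open>x\<close> and \<open>y\<close> themselves for \<open>j = 0\<close>. The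
  maps \<open>D j\<close> and the coefficients of the substitution obey the same sum and product rules, so
  they agree everywhere once they agree on constants. There one needs that \<open>D j 1 = 0\<close> for
  \<open>j > 0\<close>, which is the Leibniz rule for \<open>1 * 1\<close>.
\<close>

lemma arc_of_HS:
  assumes D: "D \<in> HS base_ring (coord_ring h) m"
  shows "\<exists>\<xi> \<eta>. arc h m \<xi> \<eta> \<and> (\<forall>j f. enat j \<le> m \<longrightarrow> D j (cls h f) = cls h (series_subst \<xi> \<eta> f $ j))"
proof -
  define F where "F j f = (if j = 0 then f else SOME g. D j (cls h f) = cls h g)" for j f
  have lin: "D j \<in> linear_endos base_ring (coord_ring h)" if "enat j \<le> m" for j
    using D that by (auto simp: HS_def)
  have F: "D j (cls h f) = cls h (F j f)" if "enat j \<le> m" for j f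
  proof (cases "j = 0")
    case True
    then show ?thesis using D by (simp add: F_def HS_def)
  next
    case False
    have "D j (cls h f) \<in> carrier (coord_ring h)"
      using lin[OF that] by (auto simp: linear_endos_def)
    then have ex: "\<exists>g. D j (cls h f) = cls h g" by (auto simp: coord_ring_carrier)
    show ?thesis using False someI_ex[OF ex] by (simp add: F_def)
  qed
  have leib: "congr h (F i (f * g)) (\<Sum>a\<le>i. F a f * F (i - a) g)" if "enat i \<le> m" for i f g
  proof -
    have le: "enat l \<le> m" if "l \<le> i" for l
      using that \<open>enat i \<le> m\<close> by (meson enat_ord_simps(1) order_trans)
    have "D i (cls h f \<otimes>\<^bsub>coord_ring h\<^esub> cls h g) =
       (\<Oplus>\<^bsub>coord_ring h\<^esub>a\<in>{..i}. D a (cls h f) \<otimes>\<^bsub>coord_ring h\<^esub> D (i - a) (cls h g))"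
      using D that unfolding HS_def ball_coord_ring by blast
    then show ?thesis
      using Leibniz_coord_ring[of i D h F f g] F le by (simp add: cls_eq_iff)
  qed
  have F_add: "congr h (F j (f + g)) (F j f + F j g)" if "enat j \<le> m" for j f g
    using lin[OF that] F[OF that] unfolding linear_endos_coord_ring by (simp add: cls_eq_iff)
  have F_const_mult: "congr h (F j ([:[:c:]:] * f)) ([:[:c:]:] * F j f)" if "enat j \<le> m" for j c f
    using lin[OF that] F[OF that] unfolding linear_endos_coord_ring by (simp add: cls_eq_iff)
  have F_1: "congr h (F j 1) 0" if "enat j \<le> m" "j > 0" for j
    using that
  proof (induction j rule: less_induct)
    case (less j)
    have set: "{..j} = insert 0 (insert j {0<..<j})" using less.prems by auto
    have "congr h (F j 1) (\<Sum>a\<le>j. F a 1 * F (j - a) 1)" using leib[OF less.prems(1), of 1 1] by simp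
    also have "(\<Sum>a\<le>j. F a 1 * F (j - a) 1) =
        F j 1 + (F j 1 + (\<Sum>a\<in>{0<..<j}. F a 1 * F (j - a) 1))"
      unfolding set using less.prems by (simp add: F_def)
    also have "congr h \<dots> (F j 1 + (F j 1 + (\<Sum>a\<in>{0<..<j}. 0 * F (j - a) 1)))"
    proof (intro congr_add congr_refl congr_sum congr_mult)
      fix a assume "a \<in> {0<..<j}"
      then show "congr h (F a 1) 0" using less.prems
        by (intro less.IH) (auto intro: order_trans[OF _ less.prems(1)])
    qed
    finally have "congr h (F j 1 - F j 1) (F j 1 + F j 1 - F j 1)"
      by (intro congr_diff) auto
    then show ?case by (auto intro: congr_sym)
  qed
  define \<xi> where "\<xi> = Abs_fps (\<lambda>j. F j var_x)"
  define \<eta> where "\<eta> = Abs_fps (\<lambda>j. F j var_y)"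
  have FS: "congr h (F j f) (series_subst \<xi> \<eta> f $ j)" if "enat j \<le> m" for j f
    using that
  proof (induction f arbitrary: j rule: poly_poly_induct)
    case (const c)
    have "congr h (F j ([:[:c:]:] * 1)) ([:[:c:]:] * F j 1)" by (rule F_const_mult[OF const])
    also have "congr h \<dots> (series_subst \<xi> \<eta> [:[:c:]:] $ j)"
    proof (cases "j = 0")
      case True
      then show ?thesis by (simp add: F_def series_subst_const)
    next
      case False
      have "congr h ([:[:c:]:] * F j 1) ([:[:c:]:] * 0)"
        by (intro congr_mult F_1 const congr_refl) (use False in simp)
      then show ?thesis using False by (simp add: series_subst_const)
    qed
    finally show ?case by simp
  next
    case (add f g)
    then show ?case unfolding series_subst_add fps_add_nth
      by (meson F_add congr_add congr_trans)
  next
    case (mult f g)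
    have le: "enat l \<le> m" if "l \<le> j" for l
      using that mult.prems by (meson enat_ord_simps(1) order_trans)
    have "congr h (F j (f * g)) (\<Sum>a\<le>j. F a f * F (j - a) g)" by (rule leib[OF mult.prems])
    also have "congr h \<dots> (\<Sum>a\<le>j. series_subst \<xi> \<eta> f $ a * series_subst \<xi> \<eta> g $ (j - a))"
      by (intro congr_sum congr_mult mult.IH le) auto
    finally show ?case by (simp add: series_subst_mult fps_mult_nth atLeast0AtMost)
  qed (simp_all add: series_subst_x series_subst_y \<xi>_def \<eta>_def)
  have h: "h dvd series_subst \<xi> \<eta> h $ j" if "enat j \<le> m" for j
  proof -
    have "cls h h = cls h ([:[:0:]:] * 0)" by (simp add: cls_eq_iff congr_def)
    then have "cls h (F j h) = cls h (F j ([:[:0:]:] * 0))" using F[OF that] by metis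
    then have "congr h (F j h) 0" using F_const_mult[OF that, of 0 0]
      by (simp add: cls_eq_iff) (metis congr_trans)
    then show ?thesis using FS[OF that, of h] by (meson congr_0_iff congr_sym congr_trans)
  qed
  have "arc h m \<xi> \<eta>" using h by (simp add: arc_def \<xi>_def \<eta>_def F_def)
  moreover have "D j (cls h f) = cls h (series_subst \<xi> \<eta> f $ j)" if "enat j \<le> m" for j f
    using F[OF that] FS[OF that] by (simp add: cls_eq_iff)
  ultimately show ?thesis by blast
qed

lemma arc_vfield_cls:
  assumes "arc h m \<xi> \<eta>" "1 \<le> m"
  shows "vfield h (\<xi> $ 1) (\<eta> $ 1) (cls h f) = cls h (series_subst \<xi> \<eta> f $ 1)"
proof -
  have eq: "(\<lambda>f. \<xi> $ 1 * partial_x f + \<eta> $ 1 * partial_y f) = (\<lambda>f. series_subst \<xi> \<eta> f $ 1)"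
    using series_subst_low_order[of \<xi> \<eta>] assms by (auto simp: arc_def)
  have le: "enat 0 \<le> m" "enat 1 \<le> m" using assms(2) unfolding one_enat_def by (simp_all add: zero_enat_def[symmetric])
  have "h dvd series_subst \<xi> \<eta> f $ 1" if "h dvd f" for f
  proof -
    from that obtain g where g: "f = h * g" by blast
    show ?thesis using assms(1) le by (auto simp: g series_subst_mult fps_mult_nth arc_def)
  qed
  then show ?thesis unfolding vfield_def eq by (intro induced_cls) (simp_all add: series_subst_add)
qed

lemma HS_1_in_Der:
  assumes D: "D \<in> HS base_ring (coord_ring h) m" and m: "1 \<le> m"
  shows "D 1 \<in> Der base_ring (coord_ring h)"
proof -
  obtain \<xi> \<eta> where arc: "arc h m \<xi> \<eta>"
    "\<And>j f. enat j \<le> m \<Longrightarrow> D j (cls h f) = cls h (series_subst \<xi> \<eta> f $ j)"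
    using arc_of_HS[OF D] by blast
  have m1: "enat 1 \<le> m" using m unfolding one_enat_def .
  have "series_subst \<xi> \<eta> f $ 0 = f" for f
    using arc(1) series_subst_low_order[of \<xi> \<eta> f] by (simp add: arc_def)
  then have "D 1 (cls h (f * g)) = cls h f \<otimes>\<^bsub>coord_ring h\<^esub> D 1 (cls h g) \<oplus>\<^bsub>coord_ring h\<^esub> cls h g \<otimes>\<^bsub>coord_ring h\<^esub> D 1 (cls h f)" for f g
    by (simp add: arc(2)[OF m1] series_subst_mult fps_mult_nth algebra_simps del: One_nat_def)
       (simp add: algebra_simps)?
  moreover have "D 1 \<in> linear_endos base_ring (coord_ring h)"
    using D m1 by (auto simp: HS_def)
  ultimately show ?thesis by (simp add: Der_def ball_coord_ring)
qed

theorem IDer_eq_arcs: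
  assumes m: "1 \<le> m"
  shows "IDer base_ring (coord_ring h) m = {vfield h (\<xi> $ 1) (\<eta> $ 1) | \<xi> \<eta>. arc h m \<xi> \<eta>}"
proof (intro equalityI subsetI)
  have m1: "enat 1 \<le> m" using m unfolding one_enat_def .
  fix \<delta>
  {
    assume "\<delta> \<in> IDer base_ring (coord_ring h) m"
    then obtain D where D: "D \<in> HS base_ring (coord_ring h) m" "D 1 = \<delta>" by (auto simp: IDer_def)
    obtain \<xi> \<eta> where arc: "arc h m \<xi> \<eta>"
      "\<And>j f. enat j \<le> m \<Longrightarrow> D j (cls h f) = cls h (series_subst \<xi> \<eta> f $ j)"
      using arc_of_HS[OF D(1)] by blast
    have "\<delta> = vfield h (\<xi> $ 1) (\<eta> $ 1)"
    proof (rule coord_ring_ext)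
      show "\<delta> \<in> extensional (carrier (coord_ring h))"
        using HS_1_in_Der[OF D(1) m] D(2) by (auto simp: Der_def linear_endos_def PiE_def)
      show "\<delta> (cls h f) = vfield h (\<xi> $ 1) (\<eta> $ 1) (cls h f)" for f
        using arc(2)[OF m1] D(2) arc_vfield_cls[OF arc(1) m] by simp
    qed (simp add: vfield_def induced_extensional)
    then show "\<delta> \<in> {vfield h (\<xi> $ 1) (\<eta> $ 1) | \<xi> \<eta>. arc h m \<xi> \<eta>}" using arc(1) by blast
  next
    assume "\<delta> \<in> {vfield h (\<xi> $ 1) (\<eta> $ 1) | \<xi> \<eta>. arc h m \<xi> \<eta>}"
    then obtain \<xi> \<eta> where arc: "arc h m \<xi> \<eta>" "\<delta> = vfield h (\<xi> $ 1) (\<eta> $ 1)" by blast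
    define D where "D j = (if enat j \<le> m then induced poly_algebra (principal h) (\<lambda>f. series_subst \<xi> \<eta> f $ j) else undefined)" for j
    have D: "D \<in> HS base_ring (coord_ring h) m"
      unfolding D_def by (rule HS_of_arc[OF arc(1)])
    have "(\<lambda>f. \<xi> $ 1 * partial_x f + \<eta> $ 1 * partial_y f) = (\<lambda>f. series_subst \<xi> \<eta> f $ 1)"
      using series_subst_low_order[of \<xi> \<eta>] arc(1) by (auto simp: arc_def)
    then have "D 1 = \<delta>" by (simp add: arc(2) vfield_def D_def m1 del: One_nat_def)
    then show "\<delta> \<in> IDer base_ring (coord_ring h) m"
      using D HS_1_in_Der[OF D m] by (auto simp: IDer_def)
  }
qed

text \<open>
  A derivation \<open>\<delta>\<close> is the Hasse--Schmidt derivation \<open>(id, \<delta>)\<close> of length \<open>1\<close>. This makes the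
  description by arcs available for all derivations.
\<close>

lemma Der_eq_IDer_1: "Der base_ring (coord_ring h) = IDer base_ring (coord_ring h) 1"
proof (intro equalityI subsetI)
  interpret algebra base_ring "coord_ring h" by (rule coord_ring_algebra)
  fix \<delta> assume d: "\<delta> \<in> Der base_ring (coord_ring h)"
  define D where "D = (\<lambda>j::nat. if j = 0 then (\<lambda>x\<in>carrier (coord_ring h). x) else if j = 1 then \<delta> else undefined)"
  have idl: "(\<lambda>x\<in>carrier (coord_ring h). x) \<in> linear_endos base_ring (coord_ring h)"
    unfolding linear_endos_coord_ring by (auto simp: ball_coord_ring)
  have cl: "\<exists>g. \<delta> (cls h f) = cls h g" for f
  proof -
    have "\<delta> (cls h f) \<in> carrier (coord_ring h)"
      using d by (auto simp: Der_def linear_endos_def)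
    then show ?thesis by (auto simp: coord_ring_carrier)
  qed
  have leib: "D i (cls h f \<otimes>\<^bsub>coord_ring h\<^esub> cls h g) =
       (\<Oplus>\<^bsub>coord_ring h\<^esub>a\<in>{..i}. D a (cls h f) \<otimes>\<^bsub>coord_ring h\<^esub> D (i - a) (cls h g))"
    if i1: "i \<le> 1" for i :: nat and f g
  proof -
    obtain f' g' where *: "\<delta> (cls h f) = cls h f'" "\<delta> (cls h g) = cls h g'" using cl by metis
    consider "i = 0" | "i = 1" using i1 by linarith
    then show ?thesis
    proof cases
      case 1
      then show ?thesis by (simp add: D_def)
    next
      case 2
      have "\<delta> (cls h f \<otimes>\<^bsub>coord_ring h\<^esub> cls h g) = cls h f \<otimes>\<^bsub>coord_ring h\<^esub> \<delta> (cls h g) \<oplus>\<^bsub>coord_ring h\<^esub> cls h g \<otimes>\<^bsub>coord_ring h\<^esub> \<delta> (cls h f)"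
        using d by (simp add: Der_def ball_coord_ring del: cls_mult)
      then show ?thesis using 2 *
        by (simp add: D_def atMost_Suc algebra_simps M.finsum_insert)
    qed
  qed
  have "D \<in> HS base_ring (coord_ring h) 1"
    using d idl leib
    by (auto simp: HS_def ball_coord_ring one_enat_def Der_def D_def extensional_def PiE_def Pi_def
        simp del: cls_mult)
  moreover have "D 1 = \<delta>" by (simp add: D_def)
  ultimately show "\<delta> \<in> IDer base_ring (coord_ring h) 1"
    using d by (auto simp: IDer_def)
qed (simp add: IDer_def)

section \<open>Submodules generated by vector fields\<close>

definition tangent :: "'k::comm_ring_1 poly poly \<Rightarrow> 'k poly poly \<Rightarrow> 'k poly poly \<Rightarrow> bool" where
  "tangent h a b \<longleftrightarrow> h dvd a * partial_x h + b * partial_y h"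

lemma tangent_arc:
  assumes "tangent h a b"
  shows "arc h 1 (fps_const var_x + fps_const a * fps_X) (fps_const var_y + fps_const b * fps_X)"
    (is "arc h 1 ?X ?Y")
proof -
  have arc: "?X $ 0 = var_x" "?Y $ 0 = var_y" "?X $ 1 = a" "?Y $ 1 = b" by simp_all
  have "h dvd series_subst ?X ?Y h $ j" if "j = 0 \<or> j = 1" for j
    using that series_subst_low_order[OF arc(1,2), of h] assms arc(3,4)
    by (auto simp: tangent_def simp del: fps_add_nth)
  moreover have "j = 0 \<or> j = 1" if "enat j \<le> 1" for j using that by (auto simp: one_enat_def)
  ultimately show ?thesis using arc unfolding arc_def by blast
qed

lemma vfield_cls:
  assumes "tangent h a b"
  shows "vfield h a b (cls h f) = cls h (a * partial_x f + b * partial_y f)"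
proof -
  have arc: "(fps_const var_x + fps_const a * fps_X) $ 0 = var_x" "(fps_const var_y + fps_const b * fps_X) $ 0 = var_y" by simp_all
  show ?thesis using arc_vfield_cls[OF tangent_arc[OF assms], of f] series_subst_low_order[OF arc, of f]
    by simp
qed

lemma vfield_Der:
  assumes "tangent h a b"
  shows "vfield h a b \<in> Der base_ring (coord_ring h)"
  unfolding Der_eq_IDer_1 IDer_eq_arcs[OF order_refl]
  using tangent_arc[OF assms] by (force intro!: exI)

lemma arc_tangent:
  assumes "arc h m \<xi> \<eta>" "1 \<le> m"
  shows "tangent h (\<xi> $ 1) (\<eta> $ 1)"
proof -
  have "enat 1 \<le> m" using assms(2) unfolding one_enat_def .
  then show ?thesis
    using assms series_subst_low_order[of \<xi> \<eta> h] unfolding arc_def tangent_def by metis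
qed

lemma Der_eq_tangent:
  "Der base_ring (coord_ring h) = {vfield h a b | a b. tangent h a b}"
proof (intro equalityI subsetI)
  fix \<delta> assume "\<delta> \<in> Der base_ring (coord_ring h)"
  then show "\<delta> \<in> {vfield h a b | a b. tangent h a b}"
    unfolding Der_eq_IDer_1 IDer_eq_arcs[OF order_refl] using arc_tangent by blast
qed (use vfield_Der in blast)

lemma vfield_congr:
  assumes "tangent h a b" "congr h a a'" "congr h b b'"
  shows "vfield h a b = vfield h a' b'" "tangent h a' b'"
proof -
  have c: "congr h (a * partial_x f + b * partial_y f) (a' * partial_x f + b' * partial_y f)" for f
    by (intro congr_add congr_mult congr_refl assms)
  show t: "tangent h a' b'" using assms(1) dvd_iff_congr[OF c] unfolding tangent_def by blast
  show "vfield h a b = vfield h a' b'"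
  proof (rule coord_ring_ext[where h = h])
    show "vfield h a b (cls h f) = vfield h a' b' (cls h f)" for f
      using c by (simp add: vfield_cls assms t cls_eq_iff)
  qed (simp_all add: vfield_def induced_extensional)
qed

lemma tangent_lincomb:
  assumes "tangent h a b" "tangent h a' b'"
  shows "tangent h (u * a + v * a') (u * b + v * b')"
proof -
  have "(u * a + v * a') * partial_x h + (u * b + v * b') * partial_y h =
    u * (a * partial_x h + b * partial_y h) + v * (a' * partial_x h + b' * partial_y h)"
    by (simp add: algebra_simps)
  then show ?thesis using assms by (simp add: tangent_def)
qed

lemma Der_module_carrier: "carrier (Der_module K A) = Der K A"
  by (simp add: Der_module_def)

lemma vfield_smult:
  assumes "tangent h a b"
  shows "cls h u \<odot>\<^bsub>Der_module base_ring (coord_ring h)\<^esub> vfield h a b = vfield h (u * a) (u * b)"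
proof (rule coord_ring_ext)
  have t: "tangent h (u * a) (u * b)" using tangent_lincomb[OF assms assms, of u 0] by simp
  show "(cls h u \<odot>\<^bsub>Der_module base_ring (coord_ring h)\<^esub> vfield h a b) (cls h f) = vfield h (u * a) (u * b) (cls h f)" for f
    by (simp add: Der_module_def vfield_cls assms t distrib_left mult.assoc)
qed (simp_all add: Der_module_def vfield_def induced_extensional)

lemma vfield_add:
  assumes "tangent h a b" "tangent h a' b'"
  shows "vfield h a b \<oplus>\<^bsub>Der_module base_ring (coord_ring h)\<^esub> vfield h a' b' = vfield h (a + a') (b + b')"
proof (rule coord_ring_ext)
  have t: "tangent h (a + a') (b + b')" using tangent_lincomb[OF assms, of 1 1] by simp
  show "(vfield h a b \<oplus>\<^bsub>Der_module base_ring (coord_ring h)\<^esub> vfield h a' b') (cls h f) = vfield h (a + a') (b + b') (cls h f)" for f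
    by (simp add: Der_module_def vfield_cls assms t algebra_simps)
qed (simp_all add: Der_module_def vfield_def induced_extensional)

text \<open>
  A submodule generated by two elements consists of their linear combinations, and the module
  operations act on the components of vector fields.
\<close>

lemma Der_span_vfields:
  assumes "tangent h a b" "tangent h a' b'"
  shows "Der_span base_ring (coord_ring h) {vfield h a b, vfield h a' b'} =
    {vfield h (u * a + v * a') (u * b + v * b') | u v. True}" (is "_ = ?S")
proof -
  interpret module "coord_ring h" "Der_module base_ring (coord_ring h)"
    by (rule Der_module_module[OF coord_ring_algebra])
  have t: "tangent h (u * a + v * a') (u * b + v * b')" for u v by (rule tangent_lincomb[OF assms])
  have comb: "vfield h (u * a + v * a') (u * b + v * b') =
      cls h u \<odot>\<^bsub>Der_module base_ring (coord_ring h)\<^esub> vfield h a b \<oplus>\<^bsub>Der_module base_ring (coord_ring h)\<^esub>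
      cls h v \<odot>\<^bsub>Der_module base_ring (coord_ring h)\<^esub> vfield h a' b'" for u v
    using tangent_lincomb[OF assms, of u 0] tangent_lincomb[OF assms, of 0 v]
    by (simp add: vfield_smult assms vfield_add)
  have smS: "cls h w \<odot>\<^bsub>Der_module base_ring (coord_ring h)\<^esub> d \<in> ?S" if "d \<in> ?S" for d w
  proof -
    from that obtain u v where d: "d = vfield h (u * a + v * a') (u * b + v * b')" by blast
    have "cls h w \<odot>\<^bsub>Der_module base_ring (coord_ring h)\<^esub> d =
      vfield h ((w * u) * a + (w * v) * a') ((w * u) * b + (w * v) * b')"
      by (simp add: d vfield_smult[OF t] distrib_left mult.assoc)
    then show ?thesis by blast
  qed
  have sub: "submodule ?S (coord_ring h) (Der_module base_ring (coord_ring h))"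
  proof (rule submoduleI)
    show "?S \<subseteq> carrier (Der_module base_ring (coord_ring h))"
      using vfield_Der[OF t] by (auto simp: Der_module_carrier)
    then have S: "d \<in> carrier (Der_module base_ring (coord_ring h))" if "d \<in> ?S" for d using that by blast
    have 0: "vfield h (0 * a + 0 * a') (0 * b + 0 * b') \<in> ?S" by blast
    show "\<zero>\<^bsub>Der_module base_ring (coord_ring h)\<^esub> \<in> ?S"
      using smS[OF 0, of 0] smult_l_null[OF S[OF 0]] by (simp add: cls_zero)
    show "\<ominus>\<^bsub>Der_module base_ring (coord_ring h)\<^esub> d \<in> ?S" if "d \<in> ?S" for d
    proof -
      have "cls h (- 1) = \<ominus>\<^bsub>coord_ring h\<^esub> \<one>\<^bsub>coord_ring h\<^esub>"
        by (rule R.minus_equality[symmetric]) (simp_all add: cls_one cls_zero)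
      then have "\<ominus>\<^bsub>Der_module base_ring (coord_ring h)\<^esub> d = cls h (- 1) \<odot>\<^bsub>Der_module base_ring (coord_ring h)\<^esub> d"
        using smult_l_minus[of "\<one>\<^bsub>coord_ring h\<^esub>" d] S[OF that] by simp
      then show ?thesis using smS[OF that] by simp
    qed
    show "d \<oplus>\<^bsub>Der_module base_ring (coord_ring h)\<^esub> e \<in> ?S" if "d \<in> ?S" "e \<in> ?S" for d e
    proof -
      from that obtain u v u' v' where d: "d = vfield h (u * a + v * a') (u * b + v * b')"
        and e: "e = vfield h (u' * a + v' * a') (u' * b + v' * b')" by blast
      have "d \<oplus>\<^bsub>Der_module base_ring (coord_ring h)\<^esub> e =
        vfield h ((u + u') * a + (v + v') * a') ((u + u') * b + (v + v') * b')"
        unfolding d e vfield_add[OF t t] by (simp add: algebra_simps)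
      then show ?thesis by blast
    qed
    show "w \<odot>\<^bsub>Der_module base_ring (coord_ring h)\<^esub> d \<in> ?S" if "w \<in> carrier (coord_ring h)" "d \<in> ?S" for w d
      using that(1) smS[OF that(2)] by (auto simp: coord_ring_carrier)
  qed
  have gens: "vfield h a b \<in> ?S" "vfield h a' b' \<in> ?S"
    by (force intro: exI[of _ 1] exI[of _ 0])+
  show ?thesis
  proof (intro equalityI)
    show "Der_span base_ring (coord_ring h) {vfield h a b, vfield h a' b'} \<subseteq> ?S"
      unfolding Der_span_def using sub gens by blast
    show "?S \<subseteq> Der_span base_ring (coord_ring h) {vfield h a b, vfield h a' b'}"
      unfolding Der_span_def
    proof (intro Inter_greatest subsetI)
      fix N d assume N: "N \<in> {N. submodule N (coord_ring h) (Der_module base_ring (coord_ring h)) \<and> {vfield h a b, vfield h a' b'} \<subseteq> N}"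
        and "d \<in> ?S"
      then obtain u v where "d = vfield h (u * a + v * a') (u * b + v * b')" by blast
      then show "d \<in> N" using N submoduleE(4,5)[of N] unfolding comb by auto
    qed
  qed
qed

section \<open>The curve\<close>

definition curve :: "nat \<Rightarrow> nat \<Rightarrow> 'k::comm_ring_1 poly poly" where
  "curve n q = var_x ^ n - var_y ^ q"

lemma curve_congr: "congr (curve n q) (var_x ^ n) (var_y ^ q)"
  by (simp add: congr_def curve_def)

lemma var_x_power: "var_x ^ k = [:monom 1 k:]"
  by (induction k) (simp_all add: var_x_def monom_Suc one_pCons monom_0)

lemma var_y_power: "var_y ^ k = monom 1 k"
  by (induction k) (simp_all add: var_y_def monom_Suc monom_0 flip: one_pCons)

lemma coeff_var_x_power_mult:
  "Polynomial.coeff (var_x ^ k * f) j = monom 1 k * Polynomial.coeff f j"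
  by (simp add: var_x_power)

lemma coeff_var_y_power_mult:
  "Polynomial.coeff (var_y ^ k * f) j = (if j < k then 0 else Polynomial.coeff f (j - k))"
  by (simp add: var_y_power coeff_monom_mult)

lemma coeff_curve_mult:
  "j < q \<Longrightarrow> Polynomial.coeff (curve n q * f) j = monom 1 n * Polynomial.coeff f j"
  by (simp add: curve_def left_diff_distrib coeff_var_x_power_mult coeff_var_y_power_mult)

lemma monom_mult_eq_0D: "monom 1 k * f = 0 \<Longrightarrow> f = (0 :: 'a::comm_ring_1 poly)"
proof (rule poly_eqI)
  fix j assume "monom 1 k * f = 0"
  then have "Polynomial.coeff (monom 1 k * f) (j + k) = 0" by simp
  then show "Polynomial.coeff f j = Polynomial.coeff 0 j" by (simp add: coeff_monom_mult)
qed

lemma var_y_power_cancel: "var_y ^ k * f = 0 \<Longrightarrow> f = 0"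
  by (simp add: var_y_power monom_mult_eq_0D)

lemma var_y_power_dvdI:
  assumes "\<And>j. j < k \<Longrightarrow> Polynomial.coeff f j = 0"
  shows "var_y ^ k dvd f"
proof -
  have "f = var_y ^ k * poly_shift k f"
    by (rule poly_eqI) (use assms in \<open>auto simp: coeff_var_y_power_mult coeff_poly_shift\<close>)
  then show ?thesis by (metis dvd_triv_left)
qed

text \<open>Modulo \<open>y\<close> the curve becomes \<open>x ^ n\<close>, which is a nonzerodivisor.\<close>

lemma var_y_regular:
  assumes "q \<ge> 1" "curve n q dvd var_y ^ k * f"
  shows "curve n q dvd f"
  using assms(2)
proof (induction k)
  case (Suc k)
  then obtain g where g: "var_y ^ Suc k * f = curve n q * g" by blast
  have "monom 1 n * Polynomial.coeff g 0 = Polynomial.coeff (var_y ^ Suc k * f) 0"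
    using assms(1) by (simp only: g coeff_curve_mult)
  then have "Polynomial.coeff g 0 = 0"
    by (simp only: coeff_var_y_power_mult) (simp add: monom_mult_eq_0D)
  then have "var_y ^ 1 dvd g" by (intro var_y_power_dvdI) simp
  then obtain g' where g': "g = var_y * g'" by (auto simp: dvd_def)
  have "var_y ^ 1 * (var_y ^ k * f - curve n q * g') = 0"
    using g by (simp add: g' algebra_simps)
  then have "var_y ^ k * f - curve n q * g' = 0" by (rule var_y_power_cancel)
  then have "curve n q dvd var_y ^ k * f" by simp
  then show ?case by (rule Suc.IH)
qed simp

definition const_coeff :: "'k::comm_ring_1 poly poly \<Rightarrow> 'k" where
  "const_coeff f = Polynomial.coeff (Polynomial.coeff f 0) 0"

text \<open>
  The hypothesis says that no monomial of \<open>f\<close> lies outside the monomial ideal of \<open>x\<close> and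
  \<open>y ^ g\<close>.
\<close>

lemma ideal_x_y_power:
  assumes "\<And>i. i < g \<Longrightarrow> Polynomial.coeff (Polynomial.coeff f i) 0 = 0"
  shows "\<exists>u v. f = u * var_x + v * var_y ^ g"
  using assms
proof (induction g arbitrary: f)
  case 0
  show ?case by (rule exI[of _ 0]) simp
next
  case (Suc g)
  obtain c f' where f: "f = pCons c f'" by (cases f)
  have "Polynomial.coeff c 0 = 0" using Suc.prems[of 0] by (simp add: f)
  then obtain c' where c: "c = pCons 0 c'" by (cases c) simp
  have "\<exists>u v. f' = u * var_x + v * var_y ^ g"
    by (rule Suc.IH) (use Suc.prems[of "Suc _"] in \<open>simp add: f\<close>)
  then obtain u v where f': "f' = u * var_x + v * var_y ^ g" by blast
  have "f = [:c':] * var_x + var_y * f'" by (simp add: f c var_x_def var_y_def)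
  then have "f = ([:c':] + var_y * u) * var_x + v * var_y ^ Suc g"
    by (simp add: f' algebra_simps)
  then show ?case by blast
qed

lemma arc_curve:
  "arc (curve n q) m \<xi> \<eta> \<longleftrightarrow> \<xi> $ 0 = var_x \<and> \<eta> $ 0 = var_y \<and>
     (\<forall>j. enat j \<le> m \<longrightarrow> congr (curve n q) ((\<xi> ^ n) $ j) ((\<eta> ^ q) $ j))"
proof -
  have "series_subst \<xi> \<eta> (curve n q) = \<xi> ^ n - \<eta> ^ q"
    by (simp only: curve_def series_subst_diff series_subst_power series_subst_x series_subst_y)
  then show ?thesis by (simp add: arc_def congr_def)
qed

lemma arc_curveI:
  assumes "\<xi> $ 0 = var_x" "\<eta> $ 0 = var_y" "congr (fps_const (curve n q)) (\<xi> ^ n) (\<eta> ^ q)"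
  shows "arc (curve n q) m \<xi> \<eta>"
  using assms congr_fps_nth by (auto simp: arc_curve)

lemma partial_x_one: "partial_x 1 = 0" and partial_y_one: "partial_y 1 = 0"
  by (simp_all add: one_pCons partial_x_pCons partial_x_0 partial_y_def formal_deriv_pCons formal_deriv_0)

lemma partial_vars:
  "partial_x var_x = 1" "partial_x var_y = 0" "partial_y var_x = 0" "partial_y var_y = 1"
  by (simp_all add: var_x_def var_y_def partial_x_pCons partial_x_0 partial_y_def formal_deriv_pCons formal_deriv_0 one_pCons)

lemma partial_y_mult: "partial_y (f * g) = f * partial_y g + g * partial_y f"
  by (simp add: partial_y_def formal_deriv_mult)

lemma tangent_curve:
  fixes a b :: "'a::comm_ring_1 poly poly"
  shows
  "tangent (curve n q) a b \<longleftrightarrow>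
     congr (curve n q) (of_nat n * var_x ^ (n - 1) * a) (of_nat q * var_y ^ (q - 1) * b)"
proof -
  have px: "partial_x (f ^ k) = of_nat k * f ^ (k - 1) * partial_x f" for f :: "'a poly poly" and k
  proof (induction k)
    case (Suc k)
    have "partial_x (f ^ Suc k) = f * (of_nat k * f ^ (k - 1) * partial_x f) + f ^ k * partial_x f"
      by (simp only: power_Suc partial_x_mult Suc.IH)
    then show ?case by (cases k) (simp_all add: algebra_simps)
  qed (simp add: partial_x_one)
  have py: "partial_y (f ^ k) = of_nat k * f ^ (k - 1) * partial_y f" for f :: "'a poly poly" and k
  proof (induction k)
    case (Suc k)
    have "partial_y (f ^ Suc k) = f * (of_nat k * f ^ (k - 1) * partial_y f) + f ^ k * partial_y f"
      by (simp only: power_Suc partial_y_mult Suc.IH)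
    then show ?case by (cases k) (simp_all add: algebra_simps)
  qed (simp add: partial_y_one)
  have d: "partial_x (f - g) = partial_x f - partial_x g" "partial_y (f - g) = partial_y f - partial_y g" for f g :: "'a poly poly"
    using partial_x_add[of "f - g" g] formal_deriv_add[of "f - g" g] by (simp_all add: partial_y_def algebra_simps)
  have "partial_x (curve n q) = (of_nat n * var_x ^ (n - 1) :: 'a poly poly)"
    "partial_y (curve n q) = - (of_nat q * var_y ^ (q - 1) :: 'a poly poly)"
    by (simp_all add: curve_def d px py partial_vars)
  then show ?thesis by (simp add: tangent_def congr_def algebra_simps)
qed

lemma vfield_in_IDer:
  assumes "arc h m \<xi> \<eta>" "1 \<le> m" "congr h (\<xi> $ 1) a" "congr h (\<eta> $ 1) b"
  shows "vfield h a b \<in> IDer base_ring (coord_ring h) m"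
  unfolding IDer_eq_arcs[OF assms(2)] mem_Collect_eq
  using vfield_congr(1)[OF arc_tangent[OF assms(1,2)] assms(3,4), symmetric] assms(1) by blast

lemma IDer_subset_Der: "IDer K A m \<subseteq> Der K A"
  by (auto simp: IDer_def)

lemma nat_unit_mod_char:
  assumes "Factorial_Ring.prime p" "CHAR('a::comm_ring_1) = p" "\<not> p dvd q"
  shows "\<exists>e. of_nat q * e = (1 :: 'a)"
proof -
  have "coprime q p" using assms(1,3) by (simp add: coprime_commute prime_imp_coprime)
  moreover have "q \<noteq> 0" using assms(3) by (metis dvd_0_right)
  ultimately obtain x y where "q * x = p * y + 1" using bezout_nat[of q p] by auto
  then have "of_nat (q * x) = (of_nat (p * y + 1) :: 'a)" by simp
  then have "of_nat q * of_nat x = (1 :: 'a)" using assms(2) by (metis of_nat_CHAR of_nat_add of_nat_mult of_nat_1 mult_zero_left add_0)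
  then show ?thesis by blast
qed


section \<open>Exponents prime to the characteristic\<close>

text \<open>
  The multiple \<open>h * c\<close> in the tangency condition is cancelled by a multiple of the Euler
  derivation. What remains satisfies \<open>n * x ^ (n - 1) * a' = q * y ^ (q - 1) * b'\<close> exactly, and
  \<open>y ^ (q - 1)\<close> divides \<open>a'\<close> because multiplication by \<open>x ^ (n - 1)\<close> is injective on the coefficient
  of each power of \<open>y\<close>; so the remainder is a multiple of the second derivation.
\<close>

lemma tangent_coprime:
  fixes a b d :: "'k::comm_ring_1 poly poly"
  assumes "of_nat n * d = (1 :: 'k poly poly)" "of_nat q * e = (1 :: 'k poly poly)" "n \<ge> 1" "q \<ge> 1"
    and t: "tangent (curve n q) a b"
  shows "\<exists>u v. a = u * (of_nat q * var_x) + v * (of_nat q * var_y ^ (q - 1)) \<and>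
               b = u * (of_nat n * var_y) + v * (of_nat n * var_x ^ (n - 1))"
proof -
  define N Q where "N = (of_nat n :: 'k poly poly)" and "Q = (of_nat q :: 'k poly poly)"
  have N: "N * d = 1" and Q: "Q * e = 1" using assms by (simp_all add: N_def Q_def)
  obtain c where c: "N * var_x ^ (n - 1) * a - Q * var_y ^ (q - 1) * b = curve n q * c"
    using t unfolding tangent_curve congr_def N_def Q_def by blast
  define u where "u = d * e * c"
  have xn: "var_x ^ (n - 1) * var_x = (var_x ^ n :: 'k poly poly)" "var_y ^ (q - 1) * var_y = (var_y ^ q :: 'k poly poly)"
    using assms(3,4) by (simp_all add: power_eq_if mult.commute)
  define a' where "a' = a - u * (Q * var_x)"
  define b' where "b' = b - u * (N * var_y)"
  have "N * var_x ^ (n - 1) * a' - Q * var_y ^ (q - 1) * b' =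
     curve n q * c - N * Q * u * (var_x ^ (n - 1) * var_x - var_y ^ (q - 1) * var_y)"
    unfolding a'_def b'_def c[symmetric] by (simp add: algebra_simps)
  also have "N * Q * u = (N * d) * (Q * e) * c" by (simp add: u_def algebra_simps)
  finally have ab: "N * var_x ^ (n - 1) * a' = Q * var_y ^ (q - 1) * b'"
    unfolding xn N Q by (simp add: curve_def algebra_simps)
  have "var_x ^ (n - 1) * a' = (N * d) * var_x ^ (n - 1) * a'" by (simp add: N)
  also have "\<dots> = d * (N * var_x ^ (n - 1) * a')" by (simp add: algebra_simps)
  also have "\<dots> = d * (Q * var_y ^ (q - 1) * b')" by (simp only: ab)
  also have "\<dots> = var_y ^ (q - 1) * (d * Q * b')" by (simp add: algebra_simps)
  finally have xa: "var_x ^ (n - 1) * a' = var_y ^ (q - 1) * (d * Q * b')" .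
  have "var_y ^ (q - 1) dvd a'"
  proof (rule var_y_power_dvdI)
    fix j assume "j < q - 1"
    then have "monom 1 (n - 1) * Polynomial.coeff a' j = 0"
      by (simp only: coeff_var_x_power_mult[symmetric] xa coeff_var_y_power_mult if_True)
    then show "Polynomial.coeff a' j = 0" by (rule monom_mult_eq_0D)
  qed
  then obtain w where w: "a' = var_y ^ (q - 1) * w" by blast
  have "var_y ^ (q - 1) * (N * var_x ^ (n - 1) * w - Q * b') = 0"
    using ab by (simp add: w algebra_simps)
  then have "N * var_x ^ (n - 1) * w = Q * b'" using var_y_power_cancel by fastforce
  moreover have "e * (Q * b') = (Q * e) * b'" by (simp add: algebra_simps)
  ultimately have "b' = e * (N * var_x ^ (n - 1) * w)" using Q by simp
  then have "b = u * (N * var_y) + (e * w) * (N * var_x ^ (n - 1))"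
    unfolding b'_def by (simp add: algebra_simps)
  moreover have "a' = (Q * e) * var_y ^ (q - 1) * w" using w Q by simp
  then have "a = u * (Q * var_x) + (e * w) * (Q * var_y ^ (q - 1))"
    unfolding a'_def by (simp add: algebra_simps)
  ultimately show ?thesis unfolding N_def Q_def by blast
qed

text \<open>
  The second generator is integrated by a fractional branch, and rescaling this arc by
  \<open>1 + u * t\<close> adds the Euler part. If one exponent is \<open>1\<close> the curve is a graph, so one coordinate
  can be moved freely.
\<close>

lemma integrable_coprime:
  fixes u v e :: "'k::comm_ring_1 poly poly"
  assumes e: "of_nat q * e = (1 :: 'k poly poly)" and "n \<ge> 1" "q \<ge> 1" and m: "1 \<le> m"
  shows "vfield (curve n q) (u * (of_nat q * var_x) + v * (of_nat q * var_y ^ (q - 1)))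
               (u * (of_nat n * var_y) + v * (of_nat n * var_x ^ (n - 1)))
         \<in> IDer base_ring (coord_ring (curve n q)) m" (is "vfield ?h ?a ?b \<in> _")
proof -
  have one: "((F::'k poly poly fps) ^ k) $ 1 = of_nat k * (F $ 0) ^ (k - 1) * F $ 1" for F k
    using fps_nth_power_first_order[of 1 0 F k] by (simp add: congr_def)
  consider "n = 1" | "q = 1" | "n \<ge> 2" "q \<ge> 2" using assms(2,3) by linarith
  then show ?thesis
  proof cases
    case 1
    define \<eta> where "\<eta> = fps_const var_y + fps_const ?b * fps_X"
    \<comment> \<open>Adding the curve itself turns the constant term \<open>y ^ q\<close> into \<open>x\<close>.\<close>
    define \<xi> where "\<xi> = \<eta> ^ q + fps_const (curve n q)"
    have "congr ?h (of_nat q * var_y ^ (q - 1) * (u * var_y + v)) ?a"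
    proof -
      have "of_nat q * var_y ^ (q - 1) * (u * var_y + v) - ?a =
        of_nat q * u * (var_y ^ (q - 1) * var_y - var_x)" by (simp add: algebra_simps)
      also have "var_y ^ (q - 1) * var_y = (var_y ^ q :: 'k poly poly)"
        using \<open>q \<ge> 1\<close> by (simp add: power_eq_if mult.commute)
      also have "of_nat q * u * (var_y ^ q - var_x) = ?h * (- (of_nat q * u))"
        by (simp add: 1 curve_def algebra_simps)
      finally show ?thesis unfolding congr_def by (rule dvdI)
    qed
    then have "congr ?h (\<xi> $ 1) ?a" unfolding \<xi>_def fps_add_nth one by (simp add: \<eta>_def 1)
    moreover have "arc ?h m \<xi> \<eta>"
      by (rule arc_curveI) (simp_all add: \<xi>_def \<eta>_def fps_nth_power_0 1 curve_def congr_def)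
    moreover have "congr ?h (\<eta> $ 1) ?b" unfolding \<eta>_def fps_linear_nth by (rule congr_refl)
    ultimately show ?thesis by (intro vfield_in_IDer[OF _ m])
  next
    case 2
    define \<xi> where "\<xi> = fps_const var_x + fps_const ?a * fps_X"
    define \<eta> where "\<eta> = \<xi> ^ n - fps_const (curve n q)"
    have "congr ?h (of_nat n * var_x ^ (n - 1) * (u * var_x + v)) ?b"
    proof -
      have "of_nat n * var_x ^ (n - 1) * (u * var_x + v) - ?b =
        of_nat n * u * (var_x ^ (n - 1) * var_x - var_y)" by (simp add: algebra_simps)
      also have "var_x ^ (n - 1) * var_x = (var_x ^ n :: 'k poly poly)"
        using \<open>n \<ge> 1\<close> by (simp add: power_eq_if mult.commute)
      also have "of_nat n * u * (var_x ^ n - var_y) = ?h * (of_nat n * u)"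
        by (simp add: 2 curve_def algebra_simps)
      finally show ?thesis unfolding congr_def by (rule dvdI)
    qed
    then have "congr ?h (\<eta> $ 1) ?b" unfolding \<eta>_def fps_sub_nth one by (simp add: \<xi>_def 2)
    moreover have "arc ?h m \<xi> \<eta>"
      by (rule arc_curveI) (simp_all add: \<xi>_def \<eta>_def fps_nth_power_0 2 curve_def congr_def)
    moreover have "congr ?h (\<xi> $ 1) ?a" unfolding \<xi>_def fps_linear_nth by (rule congr_refl)
    ultimately show ?thesis by (intro vfield_in_IDer[OF _ m])
  next
    case 3
    obtain B where B: "B $ 0 = var_y" "B $ 1 = e * of_nat n * var_x ^ (n - 1) * (of_nat q * v)"
      "congr (fps_const ?h) ((fps_const var_x + fps_const (var_y ^ (q - 1) * (of_nat q * v)) * fps_X) ^ n) (B ^ q)"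
      using branch_exists[OF e 3 curve_congr var_y_regular[OF assms(3), where k=1, unfolded power_one_right]]
      by blast
    define F where "F = fps_const var_x + fps_const (var_y ^ (q - 1) * (of_nat q * v)) * fps_X"
    define S where "S = 1 + fps_const u * fps_X"
    have "arc ?h m (S ^ q * F) (S ^ n * B)"
      by (rule arc_curveI[OF _ _ rescale_congr[OF B(3)[folded F_def]]])
         (simp_all add: power_linear_nth_1 S_def F_def B)
    moreover have "(S ^ q * F) $ 1 = ?a"
      using power_linear_nth_1[of u q] by (simp add: fps_mult_nth S_def F_def algebra_simps)
    moreover have "(S ^ n * B) $ 1 = ?b"
    proof -
      have "(S ^ n * B) $ 1 = u * (of_nat n * var_y) + (of_nat q * e) * (of_nat n * var_x ^ (n - 1) * v)"
        using power_linear_nth_1[of u n] B by (simp add: fps_mult_nth S_def algebra_simps)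
      then show ?thesis unfolding e by (simp add: algebra_simps del: One_nat_def)
    qed
    ultimately show ?thesis using vfield_in_IDer[OF _ m congr_refl congr_refl] by metis
  qed
qed

lemma IDer_coprime_curve:
  fixes n q p :: nat
  defines "h \<equiv> (curve n q :: 'k::comm_ring_1 poly poly)"
  assumes p: "Factorial_Ring.prime p" "CHAR('k) = p" and nq: "n \<ge> 1" "q \<ge> 1" "\<not> p dvd n" "\<not> p dvd q"
    and m: "1 \<le> m"
  shows "IDer base_ring (coord_ring h) m = Der base_ring (coord_ring h)"
    and "Der base_ring (coord_ring h) = Der_span base_ring (coord_ring h)
       {vfield h (of_nat q * var_x) (of_nat n * var_y),
        vfield h (of_nat q * var_y ^ (q - 1)) (of_nat n * var_x ^ (n - 1))}" (is "_ = ?S")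
proof -
  have char: "CHAR('k poly poly) = p" using p by simp
  obtain d e where de: "of_nat n * d = (1 :: 'k poly poly)" "of_nat q * e = (1 :: 'k poly poly)"
    using nat_unit_mod_char[OF p(1) char] nq by metis
  have "of_nat n * var_x ^ (n - 1) * (of_nat q * var_x) - of_nat q * var_y ^ (q - 1) * (of_nat n * var_y)
      = of_nat n * of_nat q * (var_x * var_x ^ (n - 1) - var_y * var_y ^ (q - 1) :: 'k poly poly)"
    by (simp add: algebra_simps)
  also have "var_x * var_x ^ (n - 1) - var_y * var_y ^ (q - 1) = h"
    using nq by (simp add: h_def curve_def flip: power_Suc)
  finally have t1: "tangent h (of_nat q * var_x) (of_nat n * var_y)"
    unfolding h_def tangent_curve congr_def by simp
  have t2: "tangent h (of_nat q * var_y ^ (q - 1)) (of_nat n * var_x ^ (n - 1))"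
    unfolding h_def tangent_curve congr_def by (simp add: algebra_simps)
  note span = Der_span_vfields[OF t1 t2]
  have "?S \<subseteq> IDer base_ring (coord_ring h) m"
    unfolding span using integrable_coprime[OF de(2) nq(1,2) m] unfolding h_def by blast
  moreover have "Der base_ring (coord_ring h) \<subseteq> ?S"
  proof
    fix \<delta> assume "\<delta> \<in> Der base_ring (coord_ring h)"
    then obtain a b where ab: "\<delta> = vfield h a b" "tangent h a b" unfolding Der_eq_tangent by blast
    show "\<delta> \<in> ?S"
      using tangent_coprime[OF de nq(1,2) ab(2)[unfolded h_def]] unfolding span ab(1) by blast
  qed
  ultimately show "IDer base_ring (coord_ring h) m = Der base_ring (coord_ring h)"
    "Der base_ring (coord_ring h) = ?S"
    using IDer_subset_Der[of base_ring "coord_ring h" m] by blast+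
qed

section \<open>Horizontal exponent divisible by the characteristic\<close>

text \<open>The parameter \<open>ty\<close> only names the coefficient ring.\<close>

locale inseparable_curve =
  fixes p n q \<alpha> s :: nat and ty :: "'k::comm_ring_1 itself"
  assumes p: "Factorial_Ring.prime p" and char: "CHAR('k) = p"
    and reduced: "\<And>(a::'k) j. a ^ j = 0 \<Longrightarrow> a = 0"
    and n: "n = p ^ \<alpha> * s" and a1: "\<alpha> \<ge> 1" and s: "s \<ge> 1" "\<not> p dvd s"
    and q: "q \<ge> 1" "\<not> p dvd q"
begin

abbreviation P :: nat where "P \<equiv> p ^ \<alpha>"

abbreviation h :: "'k poly poly" where "h \<equiv> curve n q"

lemma p2: "p \<ge> 2"
  using p by (rule prime_ge_2_nat)

lemma p_pos [simp]: "0 < p" "p \<noteq> 0"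
  using p2 by auto

lemma P2: "P \<ge> 2"
proof -
  have "p ^ 1 \<le> P" using p2 a1 by (intro power_increasing) auto
  then show ?thesis using p2 by simp
qed

lemma of_nat_n: "of_nat n = (0 :: 'k poly poly)"
proof -
  have "p dvd n" using a1 by (simp add: n)
  then show ?thesis using char by (simp add: of_nat_eq_0_iff_char_dvd)
qed

lemma char_poly: "CHAR('k poly poly) = p"
  by (simp add: char)

lemma tangent_iff: "tangent h a b \<longleftrightarrow> h dvd b"
proof -
  obtain e where e: "of_nat q * e = (1 :: 'k poly poly)"
    using nat_unit_mod_char[OF p char_poly q(2)] by blast
  have "tangent h a b \<longleftrightarrow> h dvd of_nat q * var_y ^ (q - 1) * b"
    unfolding tangent_curve of_nat_n by (simp add: congr_def)
  also have "\<dots> \<longleftrightarrow> h dvd b"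
  proof
    assume "h dvd of_nat q * var_y ^ (q - 1) * b"
    then have "h dvd e * (of_nat q * var_y ^ (q - 1) * b)" by (rule dvd_mult)
    also have "e * (of_nat q * var_y ^ (q - 1) * b) = (of_nat q * e) * (var_y ^ (q - 1) * b)"
      by (simp add: algebra_simps)
    finally have "h dvd var_y ^ (q - 1) * b" unfolding e by simp
    then show "h dvd b" by (rule var_y_regular[OF q(1)])
  qed (rule dvd_mult)
  finally show ?thesis .
qed

lemma Der_horizontal: "Der base_ring (coord_ring h) = {vfield h a 0 | a. True}"
proof (intro equalityI subsetI)
  fix \<delta> assume "\<delta> \<in> Der base_ring (coord_ring h)"
  then obtain a b where ab: "\<delta> = vfield h a b" "tangent h a b" unfolding Der_eq_tangent by blast
  then have "congr h b 0" by (simp add: tangent_iff congr_def)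
  then show "\<delta> \<in> {vfield h a 0 | a. True}"
    using vfield_congr(1)[OF ab(2) congr_refl] ab(1) by blast
qed (auto simp: Der_eq_tangent tangent_iff)

lemma arc_horizontal:
  assumes "arc h m \<xi> \<eta>" "1 \<le> m"
  shows "vfield h (\<xi> $ 1) 0 \<in> IDer base_ring (coord_ring h) m"
  using arc_tangent[OF assms] by (intro vfield_in_IDer[OF assms]) (simp_all add: tangent_iff congr_0_iff)

lemma IDer_horizontal:
  assumes "1 \<le> m"
  shows "IDer base_ring (coord_ring h) m = {vfield h (\<xi> $ 1) 0 | \<xi> \<eta>. arc h m \<xi> \<eta>}"
proof (intro equalityI subsetI)
  fix \<delta> assume "\<delta> \<in> IDer base_ring (coord_ring h) m"
  then obtain \<xi> \<eta> where arc: "\<delta> = vfield h (\<xi> $ 1) (\<eta> $ 1)" "arc h m \<xi> \<eta>"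
    unfolding IDer_eq_arcs[OF assms] by blast
  have t: "tangent h (\<xi> $ 1) (\<eta> $ 1)" by (rule arc_tangent[OF arc(2) assms])
  then have "congr h (\<eta> $ 1) 0" by (simp add: tangent_iff congr_def)
  then show "\<delta> \<in> {vfield h (\<xi> $ 1) 0 | \<xi> \<eta>. arc h m \<xi> \<eta>}"
    using vfield_congr(1)[OF t congr_refl] arc by blast
qed (use arc_horizontal[OF _ assms] in blast)

lemma span_horizontal:
  "Der_span base_ring (coord_ring h) {vfield h a 0, vfield h a' 0} =
     {vfield h (u * a + v * a') 0 | u v. True}"
  by (subst Der_span_vfields) (simp_all add: tangent_iff)

lemma Der_eq_span: "Der base_ring (coord_ring h) = Der_span base_ring (coord_ring h) {vfield h 1 0}"
proof -
  have "{vfield h (u * 1 + v * 1) 0 | u v. True} = {vfield h a 0 | a. True}"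
    by auto (metis add.right_neutral)
  then show ?thesis using span_horizontal[of 1 1] by (simp add: Der_horizontal)
qed

lemma xi_power_low:
  assumes "0 < j" "j < P"
  shows "((\<xi> :: 'k poly poly fps) ^ n) $ j = 0"
proof -
  have "(\<xi> ^ P) $ i = 0" if "0 < i" "i < P" for i
    using that by (auto simp: fps_nth_char_power[OF p char_poly] dest: dvd_imp_le)
  then show ?thesis
    using assms fps_nth_power_first_order[of P 0 "\<xi> ^ P" s] P2 by (simp add: n power_mult)
qed

lemma xi_power_P:
  "((\<xi> :: 'k poly poly fps) ^ n) $ P = of_nat s * (\<xi> $ 0) ^ (P * (s - 1)) * (\<xi> $ 1) ^ P"
proof -
  have "(\<xi> ^ P) $ i = 0" if "0 < i" "i < P" for i
    using that by (auto simp: fps_nth_char_power[OF p char_poly] dest: dvd_imp_le)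
  moreover have "(\<xi> ^ P) $ P = (\<xi> $ 1) ^ P" "(\<xi> ^ P) $ 0 = (\<xi> $ 0) ^ P"
    using P2 by (simp_all add: fps_nth_char_power[OF p char_poly])
  ultimately show ?thesis
    using fps_nth_power_first_order[of P 0 "\<xi> ^ P" s] P2
    by (simp add: n power_mult congr_def)
qed

text \<open>
  Moving \<open>x\<close> to \<open>x + a * t\<close> does not change \<open>x ^ P\<close> below order \<open>P\<close>, so \<open>y\<close> can stay fixed.
\<close>

lemma IDer_below_P:
  assumes "1 \<le> m" "m < enat P"
  shows "IDer base_ring (coord_ring h) m = Der base_ring (coord_ring h)"
proof
  show "Der base_ring (coord_ring h) \<subseteq> IDer base_ring (coord_ring h) m"
  proof
    fix \<delta> assume "\<delta> \<in> Der base_ring (coord_ring h)"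
    then obtain a where a: "\<delta> = vfield h a 0" by (auto simp: Der_horizontal)
    define \<xi> where "\<xi> = fps_const var_x + fps_const a * fps_X"
    have "congr h ((\<xi> ^ n) $ j) ((fps_const var_y ^ q) $ j)" if "enat j \<le> m" for j
    proof (cases "j = 0")
      case True
      then show ?thesis using curve_congr by (simp add: fps_nth_power_0 \<xi>_def)
    next
      case False
      have "enat j < enat P" using that assms(2) by (rule order_le_less_trans)
      then show ?thesis using False xi_power_low[of j \<xi>] by (simp add: fps_const_power)
    qed
    then have "arc h m \<xi> (fps_const var_y)" by (simp add: arc_curve \<xi>_def)
    then show "\<delta> \<in> IDer base_ring (coord_ring h) m"
      using arc_horizontal[OF _ assms(1), of \<xi>] a by (simp add: \<xi>_def)
  qed
qed (rule IDer_subset_Der)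

text \<open>
  Below order \<open>P\<close> the left-hand side of the equation is constant, which forces the coefficients
  of \<open>\<eta>\<close> to vanish one after the other. At order \<open>P\<close> only the linear terms in \<open>(\<xi> $ 1) ^ P\<close> and
  \<open>\<eta> $ P\<close> survive.
\<close>

lemma arc_conditions:
  assumes "arc h m \<xi> \<eta>" "enat P \<le> m"
  shows "\<And>j. 0 < j \<Longrightarrow> j < P \<Longrightarrow> h dvd \<eta> $ j"
    and "congr h (of_nat s * var_x ^ (P * (s - 1)) * (\<xi> $ 1) ^ P) (of_nat q * var_y ^ (q - 1) * \<eta> $ P)"
proof -
  have 0: "\<xi> $ 0 = var_x" "\<eta> $ 0 = var_y" using assms(1) by (simp_all add: arc_curve)
  have c: "congr h ((\<xi> ^ n) $ j) ((\<eta> ^ q) $ j)" if "j \<le> P" for j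
    using assms that by (meson arc_curve enat_ord_simps(1) order_trans)
  show low: "h dvd \<eta> $ j" if "0 < j" "j < P" for j
    using that
  proof (induction j rule: less_induct)
    case (less j)
    have "congr h ((\<eta> ^ q) $ j) (of_nat q * var_y ^ (q - 1) * \<eta> $ j)"
      using fps_nth_power_first_order[of j h \<eta> q] less 0 by simp
    moreover have "congr h 0 ((\<eta> ^ q) $ j)"
      using c[of j] xi_power_low[of j \<xi>] less.prems by simp
    ultimately have "congr h 0 (of_nat q * var_y ^ (q - 1) * \<eta> $ j)" by (metis congr_trans)
    then have "tangent h 0 (\<eta> $ j)" by (simp add: tangent_curve of_nat_n)
    then show ?case by (simp add: tangent_iff)
  qed
  have "congr h ((\<eta> ^ q) $ P) (of_nat q * var_y ^ (q - 1) * \<eta> $ P)"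
    using fps_nth_power_first_order[of P h \<eta> q] low 0 P2 by simp
  with c[OF order_refl] have "congr h ((\<xi> ^ n) $ P) (of_nat q * var_y ^ (q - 1) * \<eta> $ P)"
    by (rule congr_trans)
  then show "congr h (of_nat s * var_x ^ (P * (s - 1)) * (\<xi> $ 1) ^ P) (of_nat q * var_y ^ (q - 1) * \<eta> $ P)"
    unfolding xi_power_P 0 .
qed

text \<open>
  Compare in the equation of order \<open>P\<close> the coefficients of \<open>x ^ (n - P) * y ^ (i * P)\<close>. For
  \<open>i * P < q - 1\<close> neither the ideal of \<open>h\<close> nor the multiples of \<open>y ^ (q - 1)\<close> contribute, and so the
  \<open>P\<close>-th power of the coefficient of the monomial \<open>y ^ i\<close> in \<open>\<xi> $ 1\<close> is zero.
\<close>

lemma arc_leading_ideal: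
  assumes "arc h m \<xi> \<eta>" "enat P \<le> m" and g: "\<And>i. i < g \<Longrightarrow> i * P < q - 1"
  shows "\<exists>u v. \<xi> $ 1 = u * var_x + v * var_y ^ g"
proof (rule ideal_x_y_power)
  fix i assume i: "i < g"
  obtain d where d: "of_nat s * d = (1 :: 'k poly poly)"
    using nat_unit_mod_char[OF p char_poly s(2)] by blast
  define a where "a = \<xi> $ 1"
  obtain r where r: "of_nat s * var_x ^ (P * (s - 1)) * a ^ P - of_nat q * var_y ^ (q - 1) * \<eta> $ P = h * r"
    using arc_conditions(2)[OF assms(1,2)] unfolding congr_def a_def by blast
  have "var_x ^ (P * (s - 1)) * a ^ P = (of_nat s * d) * (var_x ^ (P * (s - 1)) * a ^ P)"
    unfolding d by simp
  also have "\<dots> = d * (h * r + of_nat q * var_y ^ (q - 1) * \<eta> $ P)"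
    unfolding r[symmetric] by (simp add: algebra_simps)
  also have "\<dots> = h * (d * r) + var_y ^ (q - 1) * (d * of_nat q * \<eta> $ P)"
    by (simp add: algebra_simps)
  finally have eq: "Polynomial.coeff (var_x ^ (P * (s - 1)) * a ^ P) (i * P) =
      Polynomial.coeff (h * (d * r) + var_y ^ (q - 1) * (d * of_nat q * \<eta> $ P)) (i * P)" by simp
  have "i * P < q - 1" by (rule g[OF i])
  then have "monom 1 (P * (s - 1)) * Polynomial.coeff (a ^ P) (i * P) =
      monom 1 n * Polynomial.coeff (d * r) (i * P)"
    using eq by (simp add: coeff_var_x_power_mult coeff_var_y_power_mult coeff_curve_mult del: One_nat_def)
  then have "Polynomial.coeff (Polynomial.coeff (a ^ P) (i * P)) 0 = 0"
  proof -
    have "P * (s - 1) < n" using P2 s(1) by (simp add: n)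
    assume "monom 1 (P * (s - 1)) * Polynomial.coeff (a ^ P) (i * P) =
      monom 1 n * Polynomial.coeff (d * r) (i * P)"
    then have "Polynomial.coeff (monom 1 (P * (s - 1)) * Polynomial.coeff (a ^ P) (i * P)) (P * (s - 1)) =
      Polynomial.coeff (monom 1 n * Polynomial.coeff (d * r) (i * P)) (P * (s - 1))" by simp
    then show ?thesis using \<open>P * (s - 1) < n\<close> by (simp add: coeff_monom_mult del: One_nat_def)
  qed
  moreover have "Polynomial.coeff (a ^ P) (i * P) = (Polynomial.coeff a i) ^ P"
    using P2 coeff_char_power[OF p, of a \<alpha> "i * P"] char by simp
  ultimately have "(Polynomial.coeff (Polynomial.coeff a i) 0) ^ P = 0"
    by (simp add: coeff_0_power)
  then show "Polynomial.coeff (Polynomial.coeff (\<xi> $ 1) i) 0 = 0" unfolding a_def by (rule reduced)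
qed

text \<open>
  With \<open>z = x ^ P\<close> the series \<open>x + v * y ^ g * t\<close> has \<open>P\<close>-th power
  \<open>z + v ^ P * y ^ (g * P) * t ^ P\<close>. As \<open>y ^ (g * P)\<close> is a multiple of \<open>y ^ q = z ^ s\<close>, the factor \<open>z\<close>
  can be taken out, and a root of the remaining unit gives \<open>\<eta>\<close>. Rescaling adds the multiple of
  \<open>x * \<partial>x\<close>; note that the Euler derivation is \<open>q * x * \<partial>x\<close>, as \<open>n = 0\<close> in \<open>k\<close>.
\<close>

lemma integrable_large_exponent:
  assumes g: "q \<le> g * P" and m: "1 \<le> m"
  shows "vfield h (u * var_x + v * var_y ^ g) 0 \<in> IDer base_ring (coord_ring h) m"
proof -
  obtain e where e: "of_nat q * e = (1 :: 'k poly poly)"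
    using nat_unit_mod_char[OF p char_poly q(2)] by blast
  define z where "z = (var_x ^ P :: 'k poly poly)"
  have zs: "z ^ s = var_x ^ n" by (simp add: z_def n power_mult)
  define w where "w = z ^ (s - 1) * var_y ^ (g * P - q) * v ^ P"
  have "((1 + fps_const w * fps_X ^ P) ^ s) $ 0 = 1" by (simp add: fps_nth_power_0 power_0_left)
  then obtain W where W: "W $ 0 = 1" "W ^ q = (1 + fps_const w * fps_X ^ P) ^ s"
    using fps_root_exists[OF e] by blast
  define F where "F = fps_const var_x + fps_const (v * var_y ^ g) * fps_X"
  define S where "S = 1 + fps_const (e * u) * fps_X"
  have "congr (fps_const h) (F ^ n) ((fps_const var_y * W) ^ q)"
  proof -
    have "F ^ P = fps_const z + fps_const ((v * var_y ^ g) ^ P) * fps_X ^ P"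
      unfolding F_def z_def by (rule char_power_linear[OF p char_poly])
    also have "(v * var_y ^ g) ^ P = var_y ^ q * (var_y ^ (g * P - q) * v ^ P)"
      using g by (simp add: power_mult_distrib mult.assoc[symmetric] flip: power_add power_mult)
    finally have "F ^ n = (fps_const z + fps_const (var_y ^ q * (var_y ^ (g * P - q) * v ^ P)) * fps_X ^ P) ^ s"
      by (simp add: n power_mult)
    also have "congr (fps_const h) \<dots> ((fps_const z + fps_const (z ^ s * (var_y ^ (g * P - q) * v ^ P)) * fps_X ^ P) ^ s)"
      unfolding zs by (intro congr_power congr_add congr_mult congr_refl congr_fps_const congr_sym[OF curve_congr])
    also have "z ^ s = z * z ^ (s - 1)" using s(1) by (simp add: power_eq_if)
    also have "fps_const z + fps_const (z * z ^ (s - 1) * (var_y ^ (g * P - q) * v ^ P)) * fps_X ^ P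
        = fps_const z * (1 + fps_const w * fps_X ^ P)"
      by (simp add: w_def algebra_simps flip: fps_const_mult)
    also have "(fps_const z * (1 + fps_const w * fps_X ^ P)) ^ s = fps_const (var_x ^ n) * W ^ q"
      by (simp add: power_mult_distrib W(2) fps_const_power zs)
    also have "congr (fps_const h) \<dots> (fps_const (var_y ^ q) * W ^ q)"
      by (intro congr_mult congr_refl congr_fps_const curve_congr)
    also have "fps_const (var_y ^ q) * W ^ q = (fps_const var_y * W) ^ q"
      by (simp add: power_mult_distrib fps_const_power)
    finally show ?thesis .
  qed
  then have "arc h m (S ^ q * F) (S ^ n * (fps_const var_y * W))"
    by (intro arc_curveI[OF _ _ rescale_congr])
       (simp_all add: S_def F_def power_linear_nth_1 W(1))
  moreover have "(S ^ q * F) $ 1 = u * var_x + v * var_y ^ g"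
  proof -
    have "(S ^ q * F) $ 1 = (of_nat q * e) * (u * var_x) + v * var_y ^ g"
      using power_linear_nth_1[of "e * u" q] by (simp add: fps_mult_nth S_def F_def algebra_simps)
    then show ?thesis unfolding e by simp
  qed
  ultimately show ?thesis using arc_horizontal[OF _ m] by metis
qed

text \<open>
  Now \<open>x + v * y ^ g * t\<close> has \<open>P\<close>-th power \<open>z + v ^ P * y ^ (q - 1) * t ^ P\<close> with \<open>z = x ^ P\<close>, which
  is the situation of the fractional branch, in the parameter \<open>t ^ P\<close>.
\<close>

lemma integrable_boundary_exponent:
  assumes g: "g * P = q - 1" and s2: "s \<ge> 2" and q2: "q \<ge> 2" and m: "1 \<le> m"
  shows "vfield h (u * var_x + v * var_y ^ g) 0 \<in> IDer base_ring (coord_ring h) m"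
proof -
  obtain e where e: "of_nat q * e = (1 :: 'k poly poly)"
    using nat_unit_mod_char[OF p char_poly q(2)] by blast
  define z where "z = (var_x ^ P :: 'k poly poly)"
  have "congr h (z ^ s) (var_y ^ q)" using curve_congr[of n q] by (simp add: z_def n power_mult)
  then obtain B where B: "B $ 0 = var_y"
      "congr (fps_const h) ((fps_const z + fps_const (var_y ^ (q - 1) * v ^ P) * fps_X) ^ s) (B ^ q)"
    using branch_exists[OF e s2 q2 _ var_y_regular[OF q(1), where k=1, unfolded power_one_right]] by blast
  define F where "F = fps_const var_x + fps_const (v * var_y ^ g) * fps_X"
  define S where "S = 1 + fps_const (e * u) * fps_X"
  have P1: "1 \<le> P" using P2 by simp
  have "F ^ P = fps_const z + fps_const ((v * var_y ^ g) ^ P) * fps_X ^ P"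
    unfolding F_def z_def by (rule char_power_linear[OF p char_poly])
  also have "(v * var_y ^ g) ^ P = var_y ^ (q - 1) * v ^ P"
    unfolding g[symmetric] by (simp add: power_mult_distrib power_mult mult.commute)
  finally have "F ^ n = fps_inflate P ((fps_const z + fps_const (var_y ^ (q - 1) * v ^ P) * fps_X) ^ s)"
    by (simp only: n power_mult fps_inflate_power[OF P1] fps_inflate_add fps_inflate_mult[OF P1]
        fps_inflate_const[OF P1] fps_inflate_X[OF P1])
  then have "congr (fps_const h) (F ^ n) ((fps_inflate P B) ^ q)"
    using fps_inflate_congr[OF P1 B(2)] by (simp add: fps_inflate_power[OF P1])
  then have "arc h m (S ^ q * F) (S ^ n * fps_inflate P B)"
    by (intro arc_curveI[OF _ _ rescale_congr])
       (simp_all add: S_def F_def power_linear_nth_1 fps_inflate_def B(1))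
  moreover have "(S ^ q * F) $ 1 = u * var_x + v * var_y ^ g"
  proof -
    have "(S ^ q * F) $ 1 = (of_nat q * e) * (u * var_x) + v * var_y ^ g"
      using power_linear_nth_1[of "e * u" q] by (simp add: fps_mult_nth S_def F_def algebra_simps)
    then show ?thesis unfolding e by simp
  qed
  ultimately show ?thesis using arc_horizontal[OF _ m] by metis
qed

text \<open>For \<open>q = 1\<close> the curve is the graph \<open>y = x ^ n\<close>.\<close>

lemma integrable_graph:
  assumes q1: "q = 1" and m: "1 \<le> m"
  shows "vfield h a 0 \<in> IDer base_ring (coord_ring h) m"
proof -
  define \<xi> where "\<xi> = fps_const var_x + fps_const a * fps_X"
  have "arc h m \<xi> (\<xi> ^ n - fps_const h)"
    by (rule arc_curveI) (simp_all add: \<xi>_def fps_nth_power_0 q1 curve_def congr_def)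
  then show ?thesis using arc_horizontal[OF _ m, of \<xi>] by (simp add: \<xi>_def)
qed

lemma IDer_eq_span:
  assumes m: "1 \<le> m"
    and sub: "\<And>\<xi> \<eta>. arc h m \<xi> \<eta> \<Longrightarrow> \<exists>u v. \<xi> $ 1 = u * var_x + v * var_y ^ g"
    and int: "\<And>u v. vfield h (u * var_x + v * var_y ^ g) 0 \<in> IDer base_ring (coord_ring h) m"
  shows "IDer base_ring (coord_ring h) m =
         Der_span base_ring (coord_ring h) {vfield h var_x 0, vfield h (var_y ^ g) 0}"
proof -
  have "{vfield h (\<xi> $ 1) 0 | \<xi> \<eta>. arc h m \<xi> \<eta>} \<subseteq> {vfield h (u * var_x + v * var_y ^ g) 0 | u v. True}"
    using sub by force
  then show ?thesis
    using int unfolding span_horizontal IDer_horizontal[OF m] by (intro equalityI) auto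
qed

end

context inseparable_curve
begin

lemma IDer_q_1:
  assumes "q = 1" "1 \<le> m"
  shows "IDer base_ring (coord_ring h) m = Der base_ring (coord_ring h)"
proof (rule antisym[OF IDer_subset_Der])
  show "Der base_ring (coord_ring h) \<subseteq> IDer base_ring (coord_ring h) m"
    using integrable_graph[OF assms] by (auto simp: Der_horizontal)
qed

lemma IDer_from_P:
  assumes m: "1 \<le> m" "enat P \<le> m" and q2: "q \<ge> 2"
    and g: "q - 1 \<le> g * P" "\<And>i. i < g \<Longrightarrow> i * P < q - 1"
    and gen: "g * P = q - 1 \<Longrightarrow> s \<ge> 2"
  shows "IDer base_ring (coord_ring h) m =
         Der_span base_ring (coord_ring h) {vfield h var_x 0, vfield h (var_y ^ g) 0}"
proof (rule IDer_eq_span[OF m(1) arc_leading_ideal[OF _ m(2) g(2)]])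
  fix u v
  show "vfield h (u * var_x + v * var_y ^ g) 0 \<in> IDer base_ring (coord_ring h) m"
  proof (cases "g * P = q - 1")
    case True
    show ?thesis by (rule integrable_boundary_exponent[OF True gen[OF True] q2 m(1)])
  next
    case False
    then have "q \<le> g * P" using g(1) by linarith
    then show ?thesis by (rule integrable_large_exponent[OF _ m(1)])
  qed
qed

end

section \<open>The exceptional curves\<close>

text \<open>
  The curves \<open>x ^ P = y ^ q\<close> with \<open>q\<close> congruent to \<open>1\<close> modulo \<open>P\<close>. Here \<open>\<beta>\<close> is the valuation of
  \<open>q - 1\<close> and \<open>g\<close> is the least exponent with \<open>g * P \<ge> q - 1\<close>.
\<close>

locale exceptional_curve = inseparable_curve p n q \<alpha> s ty
  for p n q \<alpha> s :: nat and ty :: "'k::comm_ring_1 itself" +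
  fixes \<beta> r g :: nat
  assumes s1: "s = 1" and q_eq: "q = p ^ \<beta> * r + 1" and ab: "\<alpha> \<le> \<beta>" and r: "\<not> p dvd r"
    and g: "g * p ^ \<alpha> = q - 1"
begin

abbreviation N :: nat where "N \<equiv> p ^ \<beta>"

lemma N2: "N \<ge> 2"
proof -
  have "p ^ 1 \<le> N" using p2 a1 ab by (intro power_increasing) auto
  then show ?thesis using p2 by simp
qed

lemma n_eq: "n = P" by (simp add: n s1)

lemma q1: "q - 1 = N * r" by (simp add: q_eq)

lemma of_nat_q: "of_nat q = (1 :: 'k poly poly)"
proof -
  have "of_nat p = (0 :: 'k poly poly)" using of_nat_CHAR[where ?'a = "'k poly poly"] by (simp only: char_poly)
  moreover have "of_nat q = (of_nat p :: 'k poly poly) ^ \<beta> * of_nat r + 1"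
    unfolding q_eq by simp
  moreover have "\<beta> \<noteq> 0" using a1 ab by simp
  ultimately show ?thesis by (simp add: power_0_left)
qed

lemma eta_power: "(\<eta> :: 'k poly poly fps) ^ q = \<eta> * (\<eta> ^ r) ^ N"
proof -
  have "\<eta> ^ q = \<eta> * \<eta> ^ (r * N)" by (simp add: q_eq mult.commute)
  then show ?thesis by (simp only: power_mult)
qed

text \<open>
  The equation is \<open>\<xi> ^ P = y ^ (q - 1) * \<eta>\<close> in this range, and the \<open>P\<close>-th power of
  \<open>a = u * x + v * y ^ g\<close> is \<open>y ^ (q - 1) * (u ^ P * y + v ^ P)\<close> modulo \<open>h\<close>.
\<close>

lemma integrable_below_PN:
  assumes m: "1 \<le> m" "m < enat (P * N)"
  shows "vfield h (u * var_x + v * var_y ^ g) 0 \<in> IDer base_ring (coord_ring h) m"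
proof -
  define a where "a = u * var_x + v * var_y ^ g"
  define w where "w = u ^ P * var_y + v ^ P"
  define \<xi> where "\<xi> = fps_const var_x + fps_const a * fps_X"
  define \<eta> where "\<eta> = fps_const var_y + fps_const w * fps_X ^ P"
  have aP: "a ^ P = u ^ P * var_x ^ P + var_y ^ (q - 1) * v ^ P"
    using freshmans_dream'[of P \<alpha> "u * var_x" "v * var_y ^ g"] p char
    unfolding g[symmetric] by (simp add: a_def power_mult_distrib power_mult mult.commute)
  have xP: "\<xi> ^ n = fps_const (var_x ^ P) + fps_const (a ^ P) * fps_X ^ P"
    unfolding \<xi>_def n_eq by (rule char_power_linear[OF p char_poly])
  have yN: "((\<eta> ^ r) ^ N) $ i = (if i = 0 then var_y ^ (q - 1) else 0)" if "i < P * N" for i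
  proof (cases "N dvd i")
    case True
    then obtain k where k: "i = N * k" by blast
    then have kP: "k < P" using that N2 by (simp add: mult.commute)
    have "((\<eta> ^ r) ^ N) $ i = ((\<eta> ^ r) $ k) ^ N"
      by (simp add: fps_nth_char_power[OF p char_poly] k)
    moreover have "(\<eta> ^ r) $ k = 0" if "k > 0"
      using fps_nth_power_first_order[of P 0 \<eta> r] that kP
      by (auto simp: \<eta>_def fps_X_power_nth)
    moreover have "((\<eta> ^ r) $ 0) ^ N = var_y ^ (q - 1)"
      unfolding q1 using P2 by (simp add: fps_nth_power_0 \<eta>_def power_0_left mult.commute flip: power_mult)
    ultimately show ?thesis using N2 by (cases "k = 0") (simp_all add: k power_0_left)
  qed (auto simp: fps_nth_char_power[OF p char_poly])
  have "congr h ((\<xi> ^ n) $ j) ((\<eta> ^ q) $ j)" if "enat j \<le> m" for j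
  proof -
    have j: "j < P * N" using that m(2) by (meson enat_ord_simps(2) order_le_less_trans)
    have "(\<eta> ^ q) $ j = \<eta> $ j * var_y ^ (q - 1)"
      unfolding eta_power using fps_mult_nth_low_order[of j "(\<eta> ^ r) ^ N" \<eta>] yN j P2 N2 by auto
    then have "(\<xi> ^ n) $ j - (\<eta> ^ q) $ j =
       (if j = 0 then var_x ^ P - var_y * var_y ^ (q - 1) else
        if j = P then u ^ P * (var_x ^ P - var_y * var_y ^ (q - 1)) else 0)"
      using P2 by (auto simp: xP \<eta>_def aP w_def fps_X_power_nth algebra_simps)
    moreover have "var_x ^ P - var_y * var_y ^ (q - 1) = h"
      using q(1) by (simp add: curve_def n_eq flip: power_Suc)
    ultimately show ?thesis by (auto simp: congr_def)
  qed
  then have "arc h m \<xi> \<eta>" using P2 by (simp add: arc_curve \<xi>_def \<eta>_def)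
  moreover have "\<xi> $ 1 = a" by (simp add: \<xi>_def)
  ultimately show ?thesis using arc_horizontal[OF _ m(1)] unfolding a_def by metis
qed

text \<open>
  With \<open>\<xi> $ 1 = u * x + v * y ^ g\<close>, the equation of order \<open>P\<close> determines \<open>b = \<eta> $ P\<close> as
  \<open>u ^ P * y + v ^ P\<close> modulo \<open>h\<close>, whose constant coefficient is the \<open>P\<close>-th power of that of \<open>v\<close>. The equation
  of order \<open>P * N\<close> shows that this coefficient is zero.
\<close>

lemma arc_leading_ideal_exceptional:
  assumes arc: "arc h m \<xi> \<eta>" "enat (P * N) \<le> m"
  shows "\<exists>u v. \<xi> $ 1 = u * var_x + v * var_y ^ (g + 1)"
proof -
  have Pm: "enat P \<le> m"
  proof -
    have "enat P \<le> enat (P * N)" using N2 by simp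
    then show ?thesis using arc(2) by (rule order_trans)
  qed
  note low = arc_conditions[OF arc(1) Pm]
  have "i * P < q - 1" if "i < g" for i
    using that P2 unfolding g[symmetric] by simp
  then obtain u v where uv: "\<xi> $ 1 = u * var_x + v * var_y ^ g"
    using arc_leading_ideal[OF arc(1) Pm, of g] by blast
  define b where "b = \<eta> $ P"
  have aP: "(\<xi> $ 1) ^ P = u ^ P * var_x ^ P + var_y ^ (q - 1) * v ^ P"
    using freshmans_dream'[of P \<alpha> "u * var_x" "v * var_y ^ g"] p char
    unfolding g[symmetric] uv by (simp add: power_mult_distrib power_mult mult.commute)
  have yq: "var_y * var_y ^ (q - 1) = (var_y ^ q :: 'k poly poly)"
    using q(1) by (simp flip: power_Suc)
  have "const_coeff b = const_coeff v ^ P"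
  proof -
    have "congr h ((\<xi> $ 1) ^ P) (var_y ^ (q - 1) * b)"
      using low(2) by (simp add: s1 of_nat_q b_def)
    then obtain c where c: "(\<xi> $ 1) ^ P - var_y ^ (q - 1) * b = h * c" by (auto simp: congr_def)
    have "var_y ^ (q - 1) * (b - var_y * u ^ P - v ^ P) =
        u ^ P * (var_x ^ P - var_y * var_y ^ (q - 1)) - h * c"
      unfolding c[symmetric] aP by (simp add: algebra_simps)
    also have "\<dots> = h * (u ^ P - c)" unfolding yq by (simp add: curve_def n_eq algebra_simps)
    finally have "h dvd var_y ^ (q - 1) * (b - var_y * u ^ P - v ^ P)" by simp
    then have "h dvd b - var_y * u ^ P - v ^ P" by (rule var_y_regular[OF q(1)])
    then obtain c' where c': "b - var_y * u ^ P - v ^ P = h * c'" by blast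
    have "b = v ^ P + var_y ^ 1 * u ^ P + h * c'" by (simp add: c'[symmetric])
    then have "const_coeff b = const_coeff (v ^ P + var_y ^ 1 * u ^ P + h * c')" by (rule arg_cong)
    also have "\<dots> = const_coeff v ^ P"
      unfolding const_coeff_def coeff_add coeff_var_y_power_mult coeff_curve_mult[OF q(1)[unfolded less_eq_Suc_le[symmetric] One_nat_def]]
      using P2 n_eq by (simp add: coeff_monom_mult coeff_0_power)
    finally show ?thesis .
  qed
  moreover have "const_coeff b = 0"
  proof -
    have "congr h ((\<xi> ^ n) $ (P * N)) ((\<eta> ^ q) $ (P * N))"
      using arc by (simp add: arc_curve)
    moreover have "(\<xi> ^ n) $ (P * N) = (\<xi> $ N) ^ P"
      using P2 by (simp add: n_eq fps_nth_char_power[OF p char_poly])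
    ultimately have "congr h ((\<xi> $ N) ^ P) ((\<eta> ^ q) $ (P * N))" by simp
    \<comment> \<open>In \<open>\<eta> * (\<eta> ^ r) ^ N\<close> the second factor has, modulo \<open>h\<close>, no terms strictly between
      the orders \<open>0\<close> and \<open>P * N\<close>.\<close>
    also have "congr h ((\<eta> ^ q) $ (P * N))
        (\<eta> $ (P * N) * var_y ^ (q - 1) + var_y * (of_nat r * var_y ^ (r - 1) * b) ^ N)"
    proof -
      define G where "G = (\<eta> ^ r) ^ N"
      have \<eta>0: "\<eta> $ 0 = var_y" using arc(1) by (simp add: arc_curve)
      have fo: "(\<forall>j. 0 < j \<and> j < P \<longrightarrow> h dvd (\<eta> ^ r) $ j) \<and>
         congr h ((\<eta> ^ r) $ P) (of_nat r * (\<eta> $ 0) ^ (r - 1) * \<eta> $ P)"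
        by (rule fps_nth_power_first_order) (use P2 low(1) in auto)
      have G: "h dvd G $ i" if "0 < i" "i < P * N" for i
      proof (cases "N dvd i")
        case True
        then obtain k where k: "i = N * k" by blast
        then have "0 < k" "k < P" using that N2 by (auto simp: mult.commute)
        then have "h dvd (\<eta> ^ r) $ k" using fo by blast
        then have "h dvd ((\<eta> ^ r) $ k) ^ N" using N2 by (intro dvd_trans[OF _ dvd_power]) auto
        then show ?thesis using N2 by (simp add: G_def fps_nth_char_power[OF p char_poly] k)
      qed (simp add: G_def fps_nth_char_power[OF p char_poly])
      have G0: "G $ 0 = var_y ^ (q - 1)"
        unfolding q1 by (simp add: G_def fps_nth_power_0 \<eta>0 mult.commute flip: power_mult)
      have GP: "congr h (G $ (P * N)) ((of_nat r * var_y ^ (r - 1) * b) ^ N)"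
        using N2 fo congr_power[of h "(\<eta> ^ r) $ P" _ N]
        by (simp add: G_def fps_nth_char_power[OF p char_poly] \<eta>0 b_def)
      have set: "{0..P * N} = insert 0 (insert (P * N) {0<..<P * N})" and pos: "P * N > 0"
        using P2 N2 by auto
      have "(\<eta> ^ q) $ (P * N) = \<eta> $ (P * N) * G $ 0 + var_y * G $ (P * N) +
          (\<Sum>i\<in>{0<..<P * N}. \<eta> $ i * G $ (P * N - i))"
        unfolding eta_power G_def[symmetric] fps_mult_nth set
        using pos \<eta>0 by (simp add: algebra_simps)
      also have "congr h \<dots> (\<eta> $ (P * N) * var_y ^ (q - 1) +
          var_y * (of_nat r * var_y ^ (r - 1) * b) ^ N + 0)"
        unfolding G0
      proof (intro congr_add congr_mult congr_refl GP)
        show "congr h (\<Sum>i\<in>{0<..<P * N}. \<eta> $ i * G $ (P * N - i)) 0"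
          unfolding congr_0_iff by (intro dvd_sum dvd_mult G) auto
      qed
      finally show ?thesis by simp
    qed
    finally have "congr h ((\<xi> $ N) ^ P)
        (\<eta> $ (P * N) * var_y ^ (q - 1) + var_y * (of_nat r * var_y ^ (r - 1) * b) ^ N)" .
    then obtain c where c: "(\<xi> $ N) ^ P -
        (\<eta> $ (P * N) * var_y ^ (q - 1) + var_y * (of_nat r * var_y ^ (r - 1) * b) ^ N) = h * c"
      by (auto simp: congr_def)
    \<comment> \<open>This is \<open>q - N\<close>; the last equation is now compared at \<open>x ^ 0 * y ^ E\<close>.\<close>
    define E where "E = 1 + (r - 1) * N"
    have r1: "r \<ge> 1" using r by (cases r) auto
    have E: "E < q - 1" "E < q" "\<not> P dvd E"
    proof -
      have "(r - 1) * N + N = N * r" using r1 by (cases r) simp_all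
      then show "E < q - 1" using N2 unfolding E_def q1 by linarith
      then show "E < q" by simp
      have "P dvd (r - 1) * N" using ab by (simp add: le_imp_power_dvd)
      then have "P dvd E \<longleftrightarrow> P dvd 1" unfolding E_def by (rule dvd_add_left_iff)
      then show "\<not> P dvd E" using P2 by auto
    qed
    have "var_y * (of_nat r * var_y ^ (r - 1) * b) ^ N = var_y ^ E * (of_nat r * b) ^ N"
      by (simp add: E_def power_mult_distrib power_add algebra_simps flip: power_mult)
    then have "(\<xi> $ N) ^ P = var_y ^ (q - 1) * \<eta> $ (P * N) + var_y ^ E * (of_nat r * b) ^ N + h * c"
      using c by (simp add: algebra_simps)
    then have "Polynomial.coeff (Polynomial.coeff ((\<xi> $ N) ^ P) E) 0 =
        Polynomial.coeff (Polynomial.coeff (var_y ^ (q - 1) * \<eta> $ (P * N) + var_y ^ E * (of_nat r * b) ^ N + h * c) E) 0"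
      by simp
    moreover have "Polynomial.coeff ((\<xi> $ N) ^ P) E = 0"
      using E(3) coeff_char_power[OF p, of "\<xi> $ N" \<alpha> E] char by simp
    moreover have "0 < n" using P2 n_eq by simp
    ultimately have "const_coeff ((of_nat r * b) ^ N) = 0"
      using E by (simp add: coeff_var_y_power_mult coeff_curve_mult coeff_monom_mult const_coeff_def)
    then have "(of_nat r * const_coeff b) ^ N = 0"
      by (simp add: const_coeff_def coeff_0_power coeff_mult_0 of_nat_poly)
    then have rb: "of_nat r * const_coeff b = 0" by (rule reduced)
    obtain d where "of_nat r * d = (1 :: 'k)" using nat_unit_mod_char[OF p char r] by blast
    then have "const_coeff b = d * (of_nat r * const_coeff b)" by (simp add: mult.assoc[symmetric] mult.commute[of d])
    then show ?thesis using rb by simp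
  qed
  ultimately have "const_coeff v = 0" using reduced[of "const_coeff v" P] by simp
  then obtain v1 v2 where "v = v1 * var_x + v2 * var_y ^ 1"
    using ideal_x_y_power[of 1 v] by (auto simp: const_coeff_def)
  then have "\<xi> $ 1 = (u + v1 * var_y ^ g) * var_x + v2 * var_y ^ (g + 1)"
    unfolding uv by (simp add: algebra_simps)
  then show ?thesis by blast
qed

end

context exceptional_curve
begin

lemma IDer_between:
  assumes m: "enat P \<le> m" "m < enat (P * N)"
  shows "IDer base_ring (coord_ring h) m =
         Der_span base_ring (coord_ring h) {vfield h var_x 0, vfield h (var_y ^ g) 0}"
proof -
  have m1: "1 \<le> m"
    using P2 m(1) by (metis One_nat_def Suc_leD enat_ord_simps(1) numeral_2_eq_2 one_enat_def order_trans)
  have "i * P < q - 1" if "i < g" for i using that P2 unfolding g[symmetric] by simp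
  then show ?thesis
    by (intro IDer_eq_span[OF m1 arc_leading_ideal[OF _ m(1)]] integrable_below_PN[OF m1 m(2)])
qed

lemma IDer_from_PN:
  assumes m: "1 \<le> m" "enat (P * N) \<le> m"
  shows "IDer base_ring (coord_ring h) m =
         Der_span base_ring (coord_ring h) {vfield h var_x 0, vfield h (var_y ^ (g + 1)) 0}"
proof (rule IDer_eq_span[OF m(1) arc_leading_ideal_exceptional[OF _ m(2)]])
  have "q \<le> (g + 1) * P" using P2 g by simp
  then show "vfield h (u * var_x + v * var_y ^ (g + 1)) 0 \<in> IDer base_ring (coord_ring h) m" for u v
    by (rule integrable_large_exponent[OF _ m(1)])
qed

end

section \<open>The integrable derivations of the curve\<close>

theorem proposition2p1:
  fixes p n q \<alpha> s m \<gamma> :: nat and \<beta> :: enat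
    and h x y :: "'k::comm_ring_1 poly poly"
    and K :: "'k ring" and R :: "('k, 'k poly poly) module" and I :: "'k poly poly set"
    and A :: "('k, 'k poly poly set) module"
    and ind :: "('k poly poly \<Rightarrow> 'k poly poly) \<Rightarrow> 'k poly poly set \<Rightarrow> 'k poly poly set"
  assumes "Factorial_Ring.prime p"
    and "CHAR('k) = p"
    and reduced: "\<forall>(a::'k) j. a ^ j = 0 \<longrightarrow> a = 0"
    and "n \<ge> 1" and "q \<ge> 1"
    and "K = ring_of_type_algebra" and "R = poly_algebra" and "x = var_x" and "y = var_y"
    and "h = x ^ n - y ^ q"
    and "I = genideal R {h}"
    and "A = quot_algebra R I"
    and "ind = induced R I"
    and "\<alpha> = multiplicity p n" and "s = n div p ^ \<alpha>"
    and "m = q mod p" and "\<beta> = pval p (q - m)"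
    and "\<gamma> = (LEAST i. i * p ^ \<alpha> \<ge> q - 1)"
  shows
    "(\<not> p dvd n \<and> \<not> p dvd q \<longrightarrow>
        IDer K A \<infinity> = Der K A \<and>
        Der K A = Der_span K A
          {ind (\<lambda>f. of_nat q * x * partial_x f + of_nat n * y * partial_y f),
           ind (\<lambda>f. of_nat q * y ^ (q - 1) * partial_x f + of_nat n * x ^ (n - 1) * partial_y f)})
     \<and>
     (p dvd n \<and> q = 1 \<longrightarrow>
        IDer K A \<infinity> = Der K A \<and> Der K A = Der_span K A {ind partial_x})
     \<and>
     (\<alpha> \<ge> 1 \<and> m \<ge> 1 \<and> q \<ge> 2 \<longrightarrow>
        (s = 1 \<and> enat \<alpha> \<le> \<beta> \<and> m = 1 \<longrightarrow>
          \<comment> \<open>here \<open>\<beta>\<close> is finite: \<open>\<beta> = \<infinity>\<close> would give \<open>q = m = 1\<close>\<close>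
          (\<forall>i::enat. 1 \<le> i \<longrightarrow>
             (i < enat (p ^ \<alpha>) \<longrightarrow> IDer K A i = Der_span K A {ind partial_x}) \<and>
             (enat (p ^ \<alpha>) \<le> i \<and> i < enat (p ^ (\<alpha> + the_enat \<beta>)) \<longrightarrow>
                IDer K A i = Der_span K A
                  {ind (\<lambda>f. x * partial_x f), ind (\<lambda>f. y ^ \<gamma> * partial_x f)}) \<and>
             (enat (p ^ (\<alpha> + the_enat \<beta>)) \<le> i \<longrightarrow>
                IDer K A i = Der_span K A
                  {ind (\<lambda>f. x * partial_x f), ind (\<lambda>f. y ^ (\<gamma> + 1) * partial_x f)})))
        \<and>
        (\<not> (s = 1 \<and> enat \<alpha> \<le> \<beta> \<and> m = 1) \<longrightarrow>
          (\<forall>i::enat. 1 \<le> i \<longrightarrow>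
             (i < enat (p ^ \<alpha>) \<longrightarrow> IDer K A i = Der_span K A {ind partial_x}) \<and>
             (enat (p ^ \<alpha>) \<le> i \<longrightarrow>
                IDer K A i = Der_span K A
                  {ind (\<lambda>f. x * partial_x f), ind (\<lambda>f. y ^ \<gamma> * partial_x f)}))))"
proof -
  have h: "h = curve n q" by (simp add: curve_def assms)
  have A: "A = coord_ring (curve n q)" by (simp add: assms curve_def)
  have ind: "ind (\<lambda>f. a * partial_x f + b * partial_y f) = vfield (curve n q) a b" for a b
    by (simp add: assms vfield_def curve_def)
  have ind_x: "ind (\<lambda>f. a * partial_x f) = vfield (curve n q) a 0" for a
    using ind[of a 0] by simp
  have ind_1: "ind partial_x = vfield (curve n q) 1 0" using ind_x[of 1] by simp
  note [simp] = \<open>K = ring_of_type_algebra\<close> \<open>x = var_x\<close> \<open>y = var_y\<close> A ind ind_x ind_1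
  note p = \<open>Factorial_Ring.prime p\<close>
  have p2: "p \<ge> 2" using p by (rule prime_ge_2_nat)
  have n_pos: "n \<noteq> 0" using \<open>n \<ge> 1\<close> by simp
  have n_eq: "n = p ^ \<alpha> * s" and s_pos: "s \<ge> 1" and s_coprime: "\<not> p dvd s"
  proof -
    have "\<not> is_unit p" using p2 by auto
    then obtain s' where "n = p ^ \<alpha> * s'" "\<not> p dvd s'"
      using multiplicity_decompose'[of n p] n_pos \<open>\<alpha> = multiplicity p n\<close> by metis
    then show "n = p ^ \<alpha> * s" "\<not> p dvd s" using \<open>s = n div p ^ \<alpha>\<close> p2 by simp_all
    then show "s \<ge> 1" using n_pos by (cases s) auto
  qed
  have insep: "inseparable_curve TYPE('k) p n q \<alpha> s" if "\<alpha> \<ge> 1" "\<not> p dvd q"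
    by unfold_locales (use that assms(1-5) n_eq s_pos s_coprime in auto)
  have case1: "IDer K A \<infinity> = Der K A \<and>
        Der K A = Der_span K A
          {ind (\<lambda>f. of_nat q * x * partial_x f + of_nat n * y * partial_y f),
           ind (\<lambda>f. of_nat q * y ^ (q - 1) * partial_x f + of_nat n * x ^ (n - 1) * partial_y f)}"
    if "\<not> p dvd n" "\<not> p dvd q"
    unfolding ind using IDer_coprime_curve[where m = \<infinity>, OF assms(1,2,4,5) that] by simp
  have case2: "IDer K A \<infinity> = Der K A \<and> Der K A = Der_span K A {ind partial_x}"
    if "p dvd n" "q = 1"
  proof -
    have "\<alpha> \<ge> 1"
      using that(1) n_pos p \<open>\<alpha> = multiplicity p n\<close> multiplicity_eq_zero_iff[of n p] p2
      by (cases \<alpha>) auto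
    moreover have "\<not> p dvd q" using that(2) p2 by simp
    ultimately interpret inseparable_curve p n q \<alpha> s "TYPE('k)" by (rule insep)
    show ?thesis using IDer_q_1[OF that(2), of \<infinity>] Der_eq_span by simp
  qed
  have case3:
    "(s = 1 \<and> enat \<alpha> \<le> \<beta> \<and> m = 1 \<longrightarrow>
       (i < enat (p ^ \<alpha>) \<longrightarrow> IDer K A i = Der_span K A {ind partial_x}) \<and>
       (enat (p ^ \<alpha>) \<le> i \<and> i < enat (p ^ (\<alpha> + the_enat \<beta>)) \<longrightarrow>
          IDer K A i = Der_span K A
            {ind (\<lambda>f. x * partial_x f), ind (\<lambda>f. y ^ \<gamma> * partial_x f)}) \<and>
       (enat (p ^ (\<alpha> + the_enat \<beta>)) \<le> i \<longrightarrow>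
          IDer K A i = Der_span K A
            {ind (\<lambda>f. x * partial_x f), ind (\<lambda>f. y ^ (\<gamma> + 1) * partial_x f)})) \<and>
     (\<not> (s = 1 \<and> enat \<alpha> \<le> \<beta> \<and> m = 1) \<longrightarrow>
       (i < enat (p ^ \<alpha>) \<longrightarrow> IDer K A i = Der_span K A {ind partial_x}) \<and>
       (enat (p ^ \<alpha>) \<le> i \<longrightarrow>
          IDer K A i = Der_span K A
            {ind (\<lambda>f. x * partial_x f), ind (\<lambda>f. y ^ \<gamma> * partial_x f)}))"
    if a1: "\<alpha> \<ge> 1" and m1: "m \<ge> 1" and q2: "q \<ge> 2" and i: "1 \<le> i" for i :: enat
  proof -
    have "\<not> p dvd q" using m1 \<open>m = q mod p\<close> by auto
    then interpret inseparable_curve p n q \<alpha> s "TYPE('k)" by (rule insep[OF a1])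
    have below: "IDer K A i = Der_span K A {ind partial_x}" if "i < enat (p ^ \<alpha>)"
      using IDer_below_P[OF i that] Der_eq_span by simp
    have "q - 1 \<le> (q - 1) * p ^ \<alpha>" using P2 by simp
    then have ge: "q - 1 \<le> \<gamma> * p ^ \<alpha>"
      unfolding \<open>\<gamma> = _\<close> by (rule LeastI)
    have lt: "j * p ^ \<alpha> < q - 1" if "j < \<gamma>" for j
      using not_less_Least[of j "\<lambda>i. i * p ^ \<alpha> \<ge> q - 1"] that unfolding \<open>\<gamma> = _\<close> by simp
    show ?thesis
    proof (cases "s = 1 \<and> enat \<alpha> \<le> \<beta> \<and> m = 1")
      case True
      define b where "b = multiplicity p (q - 1)"
      have \<beta>: "\<beta> = enat b" using True q2 \<open>\<beta> = pval p (q - m)\<close> by (simp add: pval_def b_def)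
      then have ab: "\<alpha> \<le> b" using True by simp
      have "\<not> is_unit p" "q - 1 \<noteq> 0" using p2 q2 by auto
      then obtain r where r: "q - 1 = p ^ b * r" "\<not> p dvd r"
        using multiplicity_decompose'[of "q - 1" p] b_def by metis
      have "p ^ \<alpha> dvd q - 1" unfolding r(1) using ab by (simp add: le_imp_power_dvd)
      then obtain k where k: "q - 1 = p ^ \<alpha> * k" by blast
      have "\<gamma> \<le> k" unfolding \<open>\<gamma> = _\<close> by (rule Least_le) (unfold k, simp)
      then have "\<gamma> * p ^ \<alpha> \<le> q - 1" unfolding k by (simp add: mult.commute)
      then have eq: "\<gamma> * p ^ \<alpha> = q - 1" using ge by simp
      interpret exceptional_curve p n q \<alpha> s "TYPE('k)" b r \<gamma>
        by unfold_locales (use True r ab eq q2 in auto)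
      show ?thesis using True below IDer_between[of i] IDer_from_PN[OF i]
        by (simp add: \<beta> power_add)
    next
      case False
      have "s \<ge> 2" if eq: "\<gamma> * p ^ \<alpha> = q - 1"
      proof -
        have Pd: "p ^ \<alpha> dvd q - 1" unfolding eq[symmetric] by simp
        moreover have "p dvd p ^ \<alpha>" using a1 by simp
        ultimately have "p dvd q - 1" by (rule dvd_trans[rotated])
        then obtain l where "q - 1 = p * l" by blast
        then have "q = 1 + p * l" using q2 by simp
        then have "q mod p = (1 + p * l) mod p" by simp
        also have "\<dots> = 1" using p2 by (simp only: mod_mult_self2) simp
        finally have m: "m = 1" using \<open>m = q mod p\<close> by simp
        have "\<alpha> \<le> multiplicity p (q - 1)"
          using Pd p2 q2 by (intro multiplicity_geI) auto
        then have "enat \<alpha> \<le> \<beta>" using q2 m \<open>\<beta> = pval p (q - m)\<close> by (simp add: pval_def)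
        then show ?thesis using False m s_pos by auto
      qed
      then have above: "IDer K A i = Der_span K A
            {ind (\<lambda>f. x * partial_x f), ind (\<lambda>f. y ^ \<gamma> * partial_x f)}"
        if "enat (p ^ \<alpha>) \<le> i"
        using IDer_from_P[OF i that q2 ge lt] by simp
      show ?thesis using False below above by blast
    qed
  qed
  \<comment> \<open>the propositional shape of the goal, without its equations between sets of derivations\<close>
  have combine: "(C \<longrightarrow> U) \<and> (C' \<longrightarrow> U') \<and>
      (L \<longrightarrow> (D \<longrightarrow> (\<forall>i::enat. 1 \<le> i \<longrightarrow> E i)) \<and> (\<not> D \<longrightarrow> (\<forall>i. 1 \<le> i \<longrightarrow> F i)))"
    if "C \<Longrightarrow> U" "C' \<Longrightarrow> U'" "\<And>i. L \<Longrightarrow> 1 \<le> i \<Longrightarrow> (D \<longrightarrow> E i) \<and> (\<not> D \<longrightarrow> F i)"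
    for C U C' U' L D E F
    using that by blast
  show ?thesis
    by (rule combine; elim conjE; (rule case1 case2 case3; assumption))
qed

end
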